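(* Let $u\in\mathcal{W}_n$ be a packed word of type $\mathbf{m}$ with $\ell$ classes. Then for every permutation $\sigma\in\mathfrak{S}_{\ell-1}$ we have $\mathrm{sw}_{\sigma}(u)=\mathrm{sw}(u)$, where $\mathrm{sw}(u)=\mathrm{sw}_{\mathrm{id}}(u)$.
   Context: Fix a positive integer $n$. Sites are the elements of $\mathbb{Z}/n\mathbb{Z}$, identified with $1,\dots,n$ and arranged cyclically (the site after $n$ is $1$). $\mathcal{W}_n$ is the set of words $u=u_1\cdots u_n$ with letters in $\{1,2,3,\dots\}$ (indices taken mod $n$); $1^n$ is the word all of whose letters are $1$. The type of $u$ is $\mathbf{m}=(m_1,m_2,\dots)$ where $m_i$ is the number of letters of $u$ equal to $i$; its number of classes is $\ell=\max\{i: m_i\neq 0\}$; $u$ (or $\mathbf m$) is packed if $m_i\neq0$ for all $1\le i\le \ell$. Put $p_i(\mathbf{m})=m_1+\cdots+m_i$ ($p_0=0$). A queue is a subset $q\subseteq\{1,\dots,n\}$; an $r$-queue is a queue of size $r$. For a queue $q$ and $u\in\mathcal{W}_n$ the word $v=q(u)$ is defined as follows: choose a permutation $(i_1,\dots,i_n)$ of $(1,\dots,n)$ with $u_{i_1}\le\cdots\le u_{i_n}$; initially no letter of $v$ is set. Phase I: for $i=i_n,i_{n-1},\dots,i_{|q|+1}$ (in this order), find the first site $j$ weakly to the left of $i$ (cyclically) with $j\notin q$ and $v_j$ not yet set, and set $v_j=u_i+1$. Phase II: for $i=i_1,i_2,\dots,i_{|q|}$ (in this order), find the first site $j$ weakly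 to the right of $i$ (cyclically) with $j\in q$ and $v_j$ not yet set, and set $v_j=u_i$. (The result does not depend on the choice of the permutation.) For $\sigma\in\mathfrak{S}_{\ell-1}$, a $\sigma$-twisted multiline queue (MLQ) of type $\mathbf m=(m_1,\dots,m_\ell,0,0,\dots)$ (with $p_\ell(\mathbf m)=n$) is a sequence $\mathbf q=(q_1,\dots,q_{\ell-1})$ where $q_i$ is a $p_{\sigma(i)}(\mathbf m)$-queue; it acts on words by $\mathbf q(u)=q_{\ell-1}(\cdots q_2(q_1(u))\cdots)$. With commuting indeterminates $x_1,\dots,x_n$ indexed by $\mathbb{Z}/n\mathbb{Z}$, the weight of a queue is $\mathrm{wt}(q)=\prod_{i\in q}x_i$ and $\mathrm{wt}(\mathbf q)=\prod_{i=1}^{\ell-1}\mathrm{wt}(q_i)$. For a packed word $u$ of type $\mathbf m$ with $\ell$ classes and $\sigma\in\mathfrak S_{\ell-1}$, the $\sigma$-spectral weight is $\mathrm{sw}_\sigma(u)=\sum_{\mathbf q}\mathrm{wt}(\mathbf q)$, summed over all $\sigma$-twisted MLQs $\mathbf q$ of type $\mathbf m$ with $\mathbf q(1^n)=u$. *)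

theory Defs
  imports "HOL-Combinatorics.Permutations" "HOL-Library.FuncSet" "HOL-Library.Poly_Mapping"
begin

text \<open>The sites \<open>\<int>/n\<int>\<close> are represented by \<open>1, \<dots>, n\<close>, with right and left neighbours taken cyclically.\<close>

definition right_site :: "nat \<Rightarrow> nat \<Rightarrow> nat" where
  "right_site n i = (if i = n then 1 else i + 1)"

definition left_site :: "nat \<Rightarrow> nat \<Rightarrow> nat" where
  "left_site n i = (if i = 1 then n else i - 1)"

definition words :: "nat \<Rightarrow> (nat \<Rightarrow> nat) set" where
  "words n = {1..n} \<rightarrow>\<^sub>E {1..}"

definition ones :: "nat \<Rightarrow> nat \<Rightarrow> nat" where
  "ones n = (\<lambda>i\<in>{1..n}. 1)"

definition word_type :: "nat \<Rightarrow> (nat \<Rightarrow> nat) \<Rightarrow> nat \<Rightarrow> nat" where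
  "word_type n u i = card {j \<in> {1..n}. u j = i}"

definition num_classes :: "(nat \<Rightarrow> nat) \<Rightarrow> nat" where
  "num_classes m = Max {i. m i \<noteq> 0}"

definition packed :: "(nat \<Rightarrow> nat) \<Rightarrow> bool" where
  "packed m \<longleftrightarrow> (\<forall>i\<in>{1..num_classes m}. m i \<noteq> 0)"

definition psum :: "(nat \<Rightarrow> nat) \<Rightarrow> nat \<Rightarrow> nat" where
  "psum m i = (\<Sum>k=1..i. m k)"

definition queues :: "nat \<Rightarrow> nat \<Rightarrow> nat set set" where
  "queues n r = {q. q \<subseteq> {1..n} \<and> card q = r}"

text \<open>The first site satisfying \<open>P\<close> among \<open>i, f i, f (f i), \<dots>\<close>.\<close>

definition first_site :: "(nat \<Rightarrow> nat) \<Rightarrow> (nat \<Rightarrow> bool) \<Rightarrow> nat \<Rightarrow> nat" where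
  "first_site f P i = (f ^^ (LEAST k. P ((f ^^ k) i))) i"

text \<open>The word under construction is a partial map; unset letters are outside its domain.\<close>

definition phaseI_step :: "nat \<Rightarrow> nat set \<Rightarrow> (nat \<Rightarrow> nat) \<Rightarrow> nat \<Rightarrow> (nat \<rightharpoonup> nat) \<Rightarrow> (nat \<rightharpoonup> nat)" where
  "phaseI_step n q u i v =
     v(first_site (left_site n) (\<lambda>j. j \<notin> q \<and> j \<notin> dom v) i \<mapsto> u i + 1)"

definition phaseII_step :: "nat \<Rightarrow> nat set \<Rightarrow> (nat \<Rightarrow> nat) \<Rightarrow> nat \<Rightarrow> (nat \<rightharpoonup> nat) \<Rightarrow> (nat \<rightharpoonup> nat)" where
  "phaseII_step n q u i v =
     v(first_site (right_site n) (\<lambda>j. j \<in> q \<and> j \<notin> dom v) i \<mapsto> u i)"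

definition queue_run :: "nat \<Rightarrow> nat list \<Rightarrow> nat set \<Rightarrow> (nat \<Rightarrow> nat) \<Rightarrow> (nat \<rightharpoonup> nat)" where
  "queue_run n is q u =
     fold (phaseII_step n q u) (take (card q) is)
       (fold (phaseI_step n q u) (rev (drop (card q) is)) Map.empty)"

text \<open>The order \<open>(i\<^sub>1, \<dots>, i\<^sub>n)\<close> of the sites is the one sorted by letter with ties broken from
  left to right; any other order sorted by letter yields the same word.\<close>

definition queue_act :: "nat \<Rightarrow> nat set \<Rightarrow> (nat \<Rightarrow> nat) \<Rightarrow> (nat \<Rightarrow> nat)" where
  "queue_act n q u = (\<lambda>i\<in>{1..n}. the (queue_run n (sort_key u [1..<Suc n]) q u i))"

text \<open>The list \<open>[q\<^sub>1, \<dots>, q\<^sub>\<ell>\<^sub>-\<^sub>1]\<close> is indexed from 0 while \<open>\<sigma>\<close> permutes \<open>{1..\<ell> - 1}\<close>.\<close>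

definition twisted_mlqs :: "nat \<Rightarrow> (nat \<Rightarrow> nat) \<Rightarrow> (nat \<Rightarrow> nat) \<Rightarrow> nat set list set" where
  "twisted_mlqs n m \<sigma> =
     {qs. length qs = num_classes m - 1 \<and>
          (\<forall>i\<in>{1..num_classes m - 1}. qs ! (i - 1) \<in> queues n (psum m (\<sigma> i)))}"

definition mlq_act :: "nat \<Rightarrow> nat set list \<Rightarrow> (nat \<Rightarrow> nat) \<Rightarrow> (nat \<Rightarrow> nat)" where
  "mlq_act n qs u = fold (queue_act n) qs u"

text \<open>Polynomials in indeterminates indexed by \<open>nat\<close>, as finitely supported functions from
  exponent vectors to integer coefficients.\<close>

type_synonym int_mpoly = "(nat \<Rightarrow>\<^sub>0 nat) \<Rightarrow>\<^sub>0 int"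

definition Var :: "nat \<Rightarrow> int_mpoly" where
  "Var i = Poly_Mapping.single (Poly_Mapping.single i 1) 1"

definition queue_wt :: "nat set \<Rightarrow> int_mpoly" where
  "queue_wt q = (\<Prod>i\<in>q. Var i)"

definition mlq_wt :: "nat set list \<Rightarrow> int_mpoly" where
  "mlq_wt qs = prod_list (map queue_wt qs)"

definition twisted_spectral_weight :: "nat \<Rightarrow> (nat \<Rightarrow> nat) \<Rightarrow> (nat \<Rightarrow> nat) \<Rightarrow> int_mpoly" where
  "twisted_spectral_weight n \<sigma> u =
     (\<Sum>qs | qs \<in> twisted_mlqs n (word_type n u) \<sigma> \<and> mlq_act n qs (ones n) = u. mlq_wt qs)"

definition spectral_weight :: "nat \<Rightarrow> (nat \<Rightarrow> nat) \<Rightarrow> int_mpoly" where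
  "spectral_weight n u = twisted_spectral_weight n id u"

end

theory Submission imports Defs begin

text \<open>A word is encoded by the chain of its level sets \<open>{i. u\<^sub>i \<le> k}\<close>. A queue \<open>q\<close> acts by inserting \<open>q\<close>
  into the chain and replacing every other set \<open>A\<close> by the second component of the combinatorial
  \<open>R\<close>-matrix at \<open>(A, q)\<close>: match the sites of \<open>A\<close> cyclically to the right with sites of \<open>q\<close>, and move the
  unmatched sites to the other set. The map \<open>R\<close> is an involution which swaps cardinalities and
  preserves weights, so it suffices that queues \<open>(q, r)\<close> and \<open>R (q, r)\<close> act equally, which is the
  braid relation for \<open>R\<close>. Lifted to counting functions \<open>f, g\<close> on the integers, \<open>R\<close> subtracts the running
  minimum of \<open>f - g\<close> from \<open>f\<close> and adds it to \<open>g\<close> (a Pitman transform). For increasing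
  cardinalities the last component of a double exchange is a min-plus convolution, invariant under
  this transform; complementation gives the first component and conservation of the sum the
  middle one.\<close>

section \<open>Counting functions on the integers, their minima, and the exchange
  \<open>R\<close>\<close>

locale cyclic_sites =
  fixes n :: nat
  assumes n_pos: "n > 0"
begin

definition height :: "(int \<Rightarrow> int) \<Rightarrow> int" where
  "height f = f (int n) - f 0"

text \<open>Lift of a subset of the cycle to the integers: the steps of \<open>f\<close> mark its
  sites and \<open>height f\<close> is its size. On the line, cyclic matching becomes a running
  minimum.\<close>

definition counting :: "(int \<Rightarrow> int) \<Rightarrow> bool" where
  "counting f \<longleftrightarrow> (\<forall>t. f (t + 1) = f t \<or> f (t + 1) = f t + 1) \<and> (\<forall>t. f (t + int n) = f t + height f)"

text \<open>A window of one period makes the minimum one over a finite set. When \<open>W\<close>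
  does not rise over a period, it is the minimum over all \<open>s <= t\<close>
  (\<open>past_min_le\<close>).\<close>

definition past_min :: "(int \<Rightarrow> int) \<Rightarrow> int \<Rightarrow> int" where
  "past_min W t = Min (W ` {t - int n..t})"

definition future_min :: "(int \<Rightarrow> int) \<Rightarrow> int \<Rightarrow> int" where
  "future_min W t = Min (W ` {t..t + int n})"

text \<open>The heights decide the drift of \<open>f - g\<close>, hence whether its minimum over the
  whole past or over the whole future exists. In the first case \<open>R2 f g\<close> is the
  departure process of a queue with arrivals \<open>f\<close> and services \<open>g\<close>: its
  value at \<open>t\<close> is the minimum over \<open>s <= t\<close> of
  \<open>f s + (g t - g s)\<close>.\<close>

definition surplus :: "(int \<Rightarrow> int) \<Rightarrow> (int \<Rightarrow> int) \<Rightarrow> int \<Rightarrow> int" where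
  "surplus f g = (if height f \<le> height g then past_min (\<lambda>s. f s - g s) else future_min (\<lambda>s. f s - g s))"

definition R1 :: "(int \<Rightarrow> int) \<Rightarrow> (int \<Rightarrow> int) \<Rightarrow> int \<Rightarrow> int" where
  "R1 f g = (\<lambda>t. f t - surplus f g t)"

definition R2 :: "(int \<Rightarrow> int) \<Rightarrow> (int \<Rightarrow> int) \<Rightarrow> int \<Rightarrow> int" where
  "R2 f g = (\<lambda>t. g t + surplus f g t)"

lemma counting_step: "counting f \<Longrightarrow> f (t + 1) = f t \<or> f (t + 1) = f t + 1"
  and counting_period: "counting f \<Longrightarrow> f (t + int n) = f t + height f"
  by (auto simp: counting_def)

lemma periods_down:
  assumes "\<And>t. W (t + int n) \<le> (W t :: int)"
  shows "W (s + int m * int n) \<le> W s"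
proof (induction m)
  case (Suc m)
  have "W (s + int (Suc m) * int n) = W ((s + int m * int n) + int n)"
    by (simp add: algebra_simps)
  also have "\<dots> \<le> W s" using assms Suc order_trans by blast
  finally show ?case .
qed simp

lemma past_min_attained: "\<exists>s\<le>t. W s = past_min W t"
proof -
  have "Min (W ` {t - int n..t}) \<in> W ` {t - int n..t}"
    by (intro Min_in) auto
  then show ?thesis unfolding past_min_def by (smt (verit, best) atLeastAtMost_iff imageE)
qed

lemma past_min_le:
  assumes "\<And>t. W (t + int n) \<le> W t" "s \<le> t"
  shows "past_min W t \<le> W s"
proof -
  define m where "m = (t - s) div int n"
  have m: "m \<ge> 0" "m * int n + (t - s) mod int n = t - s"
    using assms(2) n_pos by (auto simp: m_def pos_imp_zdiv_nonneg_iff)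
  have "0 \<le> (t - s) mod int n" "(t - s) mod int n < int n"
    using n_pos by auto
  with m have "s + m * int n \<in> {t - int n..t}" by auto
  then have "past_min W t \<le> W (s + m * int n)"
    unfolding past_min_def by (intro Min_le) auto
  also have "\<dots> \<le> W s" using periods_down[of W s "nat m", OF assms(1)] m(1) by simp
  finally show ?thesis .
qed

lemma past_min_eqI:
  assumes "\<And>t. W (t + int n) \<le> W t" "\<And>s. s \<le> t \<Longrightarrow> k \<le> W s" "s \<le> t" "W s = k"
  shows "past_min W t = k"
proof -
  obtain r where "r \<le> t" "W r = past_min W t" using past_min_attained by blast
  with assms(2)[of r] past_min_le[of W s t, OF assms(1,3)] assms(4) show ?thesis by simp
qed

lemma future_min_past_min: "future_min W t = past_min (\<lambda>s. W (- s)) (- t)"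
proof -
  have "(\<lambda>s. W (- s)) ` {- t - int n..- t} = W ` (uminus ` {- t - int n..- t})"
    by (simp only: image_image)
  also have "uminus ` {- t - int n..- t} = {t..t + int n}" by simp
  finally show ?thesis unfolding future_min_def past_min_def by argo
qed

lemma future_min_attained: "\<exists>s\<ge>t. W s = future_min W t"
proof -
  obtain s where "s \<le> - t" "W (- s) = future_min W t"
    using past_min_attained[of "- t" "\<lambda>s. W (- s)"] unfolding future_min_past_min by blast
  then show ?thesis by (intro exI[of _ "- s"]) auto
qed

lemma future_min_le:
  assumes "\<And>t. W t \<le> W (t + int n)" "t \<le> s"
  shows "future_min W t \<le> W s"
proof -
  have "W (- (r + int n)) \<le> W (- r)" for r
    using assms(1)[of "- (r + int n)"] by simp
  from past_min_le[of "\<lambda>s. W (- s)" "- s" "- t", OF this] assms(2) show ?thesis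
    by (simp add: future_min_past_min)
qed

lemma future_min_eqI:
  assumes "\<And>t. W t \<le> W (t + int n)" "\<And>s. t \<le> s \<Longrightarrow> k \<le> W s" "t \<le> s" "W s = k"
  shows "future_min W t = k"
proof -
  obtain r where "t \<le> r" "W r = future_min W t" using future_min_attained by blast
  with assms(2)[of r] future_min_le[of W t s, OF assms(1,3)] assms(4) show ?thesis by simp
qed

section \<open>Running minimum and Pitman transform in the case of weakly downward drift\<close>

context
  fixes f g W M
  assumes f: "counting f" and g: "counting g" and fg: "height f \<le> height g"
  defines "W \<equiv> \<lambda>s. f s - g s" and "M \<equiv> past_min W"
begin

lemma diff_period: "W (t + int n) = W t + (height f - height g)"
  using counting_period[OF f] counting_period[OF g] by (simp add: W_def)

lemma diff_drift: "W (t + int n) \<le> W t"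
  using diff_period fg by simp

lemma diff_step: "W (t + 1) \<ge> W t - 1"
  using counting_step[OF f, of t] counting_step[OF g, of t] by (auto simp: W_def)

lemma run_min_le: "s \<le> t \<Longrightarrow> M t \<le> W s"
  unfolding M_def by (rule past_min_le[of W, OF diff_drift])

lemma run_min_attained: obtains s where "s \<le> t" "W s = M t"
  using past_min_attained[of t W] M_def by auto

lemma run_min_antimono: "s \<le> t \<Longrightarrow> M t \<le> M s"
  using run_min_attained[of s] run_min_le[of _ t] by (metis order_trans)

lemma run_min_Suc: "M (t + 1) = min (M t) (W (t + 1))"
proof -
  obtain s where s: "s \<le> t" "W s = M t" by (rule run_min_attained)
  obtain r where r: "r \<le> t + 1" "W r = M (t + 1)" by (rule run_min_attained)
  have "r \<le> t \<or> r = t + 1" using r by linarith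
  then show ?thesis using s r run_min_le[of r t] run_min_le[of s "t+1"] run_min_le[of "t+1" "t+1"]
    by (auto simp: min_def)
qed

lemma run_min_period: "M (t + int n) = M t + (height f - height g)"
proof -
  obtain s where s: "s \<le> t" "W s = M t" by (rule run_min_attained)
  show ?thesis unfolding M_def
  proof (rule past_min_eqI[of W "t + int n" _ "s + int n", OF diff_drift])
    fix r assume "r \<le> t + int n"
    then have "M t \<le> W (r - int n)" by (intro run_min_le) simp
    then show "past_min W t + (height f - height g) \<le> W r"
      using diff_period[of "r - int n"] by (simp add: M_def)
  qed (use s diff_period in \<open>auto simp: M_def\<close>)
qed

text \<open>\<open>M\<close> falls only where \<open>W\<close> goes below all its earlier values,
  which takes a step of \<open>g\<close> and none of \<open>f\<close>, and then by exactly one.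
  Hence the increments of \<open>f - M\<close> and \<open>g + M\<close> stay in {0, 1}.\<close>

lemma run_min_step:
  "M (t + 1) = M t \<or> M (t + 1) = M t - 1 \<and> f (t + 1) = f t \<and> g (t + 1) = g t + 1"
  using counting_step[OF f, of t] counting_step[OF g, of t] run_min_Suc[of t] run_min_le[of t t]
  unfolding W_def by (auto simp: min_def)

lemma counting_past:
  "counting (\<lambda>t. f t - M t)" "height (\<lambda>t. f t - M t) = height g"
  "counting (\<lambda>t. g t + M t)" "height (\<lambda>t. g t + M t) = height f"
proof -
  show h: "height (\<lambda>t. f t - M t) = height g" "height (\<lambda>t. g t + M t) = height f"
    using run_min_period[of 0] by (simp_all add: height_def)
  have "f (t + 1) - M (t + 1) = f t - M t \<or> f (t + 1) - M (t + 1) = f t - M t + 1"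
    "g (t + 1) + M (t + 1) = g t + M t \<or> g (t + 1) + M (t + 1) = g t + M t + 1" for t
    using counting_step[OF f, of t] counting_step[OF g, of t] run_min_step[of t] by auto
  then show "counting (\<lambda>t. f t - M t)" "counting (\<lambda>t. g t + M t)"
    unfolding counting_def h using run_min_period counting_period[OF f] counting_period[OF g] by auto
qed

text \<open>\<open>W - 2 M\<close> is the Pitman transform of \<open>W\<close>.\<close>

lemma run_min_leaves_level:
  assumes "s \<le> t" "M t < M s"
  obtains u where "s \<le> u" "u \<le> t" "W u = M s" "M u = M s"
proof -
  have "\<exists>u. s \<le> u \<and> u \<le> t \<and> W u = M s \<and> M u = M s" using assms
  proof (induction t rule: int_ge_induct)
    case (step t)
    show ?case
    proof (cases "M t < M s")
      case True
      with step show ?thesis by force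
    next
      case False
      then have "M t = M s" using run_min_antimono[OF step.hyps(1)] by simp
      with step.prems run_min_Suc[of t] have "W (t + 1) < M t" by auto
      with diff_step[of t] run_min_le[of t t] have "W t = M t" by auto
      with \<open>M t = M s\<close> step.hyps(1) show ?thesis by (intro exI[of _ t]) auto
    qed
  qed simp
  then show ?thesis using that by blast
qed

text \<open>For \<open>s >= t\<close> one has \<open>W s - 2 * M s >= - M s >= - M t\<close>.
  Equality holds just before \<open>M\<close> leaves the level \<open>M t\<close>, which happens
  within one period because the drift is strict. So the Pitman transform determines
  \<open>M\<close>, which makes \<open>R\<close> invertible.\<close>

lemma future_min_pitman:
  assumes "height f < height g"
  shows "future_min (\<lambda>s. W s - 2 * M s) t = - M t"
proof -
  obtain u where u: "t \<le> u" "W u = M t" "M u = M t"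
    using run_min_leaves_level[of t "t + int n"] run_min_period[of t] assms by auto
  show ?thesis
  proof (rule future_min_eqI[OF _ _ u(1)])
    show "W s - 2 * M s \<le> W (s + int n) - 2 * M (s + int n)" for s
      using diff_period[of s] run_min_period[of s] fg by auto
    show "- M t \<le> W s - 2 * M s" if "t \<le> s" for s
      using run_min_le[of s s] run_min_antimono[OF that] by simp
  qed (use u in simp)
qed

text \<open>For equal heights \<open>M\<close> is both antimonotone and periodic, hence constant,
  and the transform only shifts \<open>W\<close>.\<close>

lemma past_min_pitman_eq:
  assumes "height f = height g"
  shows "past_min (\<lambda>s. W s - 2 * M s) t = - M t"
proof -
  have M: "M s = M t" for s t
  proof -
    have per: "M (r + int m * int n) = M r" for r m
    proof (induction m)
      case (Suc m)
      then show ?case using run_min_period[of "r + int m * int n"] assms by (simp add: algebra_simps)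
    qed simp
    have "M r' \<le> M r" for r r'
    proof -
      define m where "m = nat \<bar>r - r'\<bar>"
      have "int m * 1 \<le> int m * int n" using n_pos by (intro mult_left_mono) auto
      then have "r \<le> r' + int m * int n" using m_def by linarith
      from run_min_antimono[OF this] per show ?thesis by simp
    qed
    then show ?thesis by (meson order_antisym)
  qed
  obtain s where s: "s \<le> t" "W s = M t" by (rule run_min_attained)
  show ?thesis
  proof (rule past_min_eqI[OF _ _ s(1)])
    show "W (t + int n) - 2 * M (t + int n) \<le> W t - 2 * M t" for t
      using diff_period[of t] run_min_period[of t] assms by simp
    show "- M t \<le> W r - 2 * M r" if "r \<le> t" for r
      using run_min_le[of r r] M[of r t] by simp
  qed (use s M[of s t] in simp)
qed

text \<open>With \<open>pitman_window_ge\<close> this says that, over the window from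
  \<open>s\<close> to \<open>t\<close>, the minimum of \<open>W\<close> is the minimum of
  \<open>W - 2 * M\<close> plus \<open>M s + M t\<close>. If \<open>M\<close> drops inside the
  window, a point where it leaves the level \<open>M s\<close> gives the value \<open>M t\<close>;
  otherwise \<open>M\<close> is constant there.\<close>

lemma pitman_window_le:
  assumes "s \<le> u" "u \<le> t"
  shows "\<exists>r. s \<le> r \<and> r \<le> t \<and> W r - 2 * M r + M s + M t \<le> W u"
proof (cases "M t < M s")
  case True
  then obtain r where "s \<le> r" "r \<le> t" "W r = M s" "M r = M s"
    using run_min_leaves_level assms by (metis order_trans)
  then show ?thesis using run_min_le[OF assms(2)] by (intro exI[of _ r]) auto
next
  case False
  then have "M t = M s" "M u = M s"
    using run_min_antimono[of s u] run_min_antimono[of u t] assms by auto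
  then show ?thesis using assms by (intro exI[of _ u]) auto
qed

lemma pitman_window_ge:
  assumes "s \<le> u" "u \<le> t"
  shows "\<exists>r. s \<le> r \<and> r \<le> t \<and> W r \<le> W u - 2 * M u + M s + M t"
proof (cases "M t < M s")
  case True
  obtain r where r: "r \<le> t" "W r = M t" by (rule run_min_attained)
  have "s \<le> r" using True r run_min_le[of r s] by fastforce
  then show ?thesis using r run_min_le[of u u] run_min_antimono[OF assms(1)] by (intro exI[of _ r]) auto
next
  case False
  then have "M t = M s" "M u = M s"
    using run_min_antimono[of s u] run_min_antimono[of u t] assms by auto
  then show ?thesis using assms by (intro exI[of _ u]) auto
qed

end

subsection \<open>Braid relation\<close>

lemma counting_rev:
  assumes "counting f"
  shows "counting (\<lambda>t. - f (- t))" "height (\<lambda>t. - f (- t)) = height f"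
proof -
  show h: "height (\<lambda>t. - f (- t)) = height f"
    using counting_period[OF assms, of "- int n"] by (simp add: height_def)
  have "- f (- (t + 1)) = - f (- t) \<or> - f (- (t + 1)) = - f (- t) + 1" for t
    using counting_step[OF assms, of "- (t + 1)"] by auto
  moreover have "- f (- (t + int n)) = - f (- t) + height f" for t
    using counting_period[OF assms, of "- (t + int n)"] by auto
  ultimately show "counting (\<lambda>t. - f (- t))" unfolding counting_def h by blast
qed

text \<open>Reflecting time and swapping \<open>f\<close> and \<open>g\<close> turns the future
  branch of \<open>surplus\<close> into the past branch, so the case
  \<open>height f > height g\<close> reduces to the other.\<close>

lemma past_min_rev: "past_min (\<lambda>s. - g (- s) - - f (- s)) t = future_min (\<lambda>s. f s - g s) (- t)"
  by (simp add: future_min_past_min)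

lemma counting_R:
  assumes f: "counting f" and g: "counting g"
  shows "counting (R1 f g)" "height (R1 f g) = height g"
    "counting (R2 f g)" "height (R2 f g) = height f"
proof -
  have "counting (R1 f g) \<and> height (R1 f g) = height g \<and> counting (R2 f g) \<and> height (R2 f g) = height f"
  proof (cases "height f \<le> height g")
    case True
    from counting_past[OF f g this] this show ?thesis by (simp add: R1_def R2_def surplus_def)
  next
    case False
    have *: "height (\<lambda>t. - g (- t)) \<le> height (\<lambda>t. - f (- t))"
      using False by (simp add: counting_rev f g)
    note p = counting_past[OF counting_rev(1)[OF g] counting_rev(1)[OF f] *, unfolded past_min_rev]
    from counting_rev[OF p(1)] counting_rev[OF p(3)] p(2,4) show ?thesis
      using False by (simp add: R1_def R2_def surplus_def counting_rev f g add.commute)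
  qed
  then show "counting (R1 f g)" "height (R1 f g) = height g"
    "counting (R2 f g)" "height (R2 f g) = height f" by auto
qed

text \<open>\<open>R1 f g - R2 f g\<close> is \<open>f - g\<close> minus twice the surplus, a Pitman
  transform. As \<open>R\<close> swaps the heights, the new surplus uses the opposite minimum if
  they differ, and again the past minimum if they agree.\<close>

lemma surplus_R:
  assumes f: "counting f" and g: "counting g"
  shows "surplus (R1 f g) (R2 f g) t = - surplus f g t"
proof -
  have eq: "(\<lambda>s. R1 f g s - R2 f g s) = (\<lambda>s. f s - g s - 2 * surplus f g s)"
    by (auto simp: R1_def R2_def)
  consider "height f < height g" | "height f = height g" | "height f > height g" by linarith
  then show ?thesis
  proof cases
    case 1
    then show ?thesis using future_min_pitman[OF f g]
      unfolding surplus_def[of "R1 f g"] eq by (simp add: counting_R f g surplus_def)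
  next
    case 2
    then show ?thesis using past_min_pitman_eq[OF f g]
      unfolding surplus_def[of "R1 f g"] eq by (simp add: counting_R f g surplus_def)
  next
    case 3
    have "future_min (\<lambda>s. - g (- s) - - f (- s) - 2 * future_min (\<lambda>s. f s - g s) (- s)) (- t)
        = - future_min (\<lambda>s. f s - g s) t"
      using future_min_pitman[OF counting_rev(1)[OF g] counting_rev(1)[OF f], unfolded past_min_rev, of "- t"] 3
      by (simp add: counting_rev f g)
    then have "past_min (\<lambda>s. f s - g s - 2 * future_min (\<lambda>s. f s - g s) s) t = - future_min (\<lambda>s. f s - g s) t"
      unfolding future_min_past_min[of _ "- t"] by simp
    then show ?thesis using 3 unfolding surplus_def[of "R1 f g"] eq
      by (simp add: counting_R f g surplus_def)
  qed
qed

lemma R_involution: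
  assumes "counting f" "counting g"
  shows "R1 (R1 f g) (R2 f g) = f" "R2 (R1 f g) (R2 f g) = g"
  unfolding R1_def[of "R1 f g"] R2_def[of "R1 f g"] surplus_R[OF assms]
  by (auto simp: R1_def R2_def)

lemma R_sum: "R1 f g t + R2 f g t = f t + g t"
  by (simp add: R1_def R2_def)

definition compl :: "(int \<Rightarrow> int) \<Rightarrow> int \<Rightarrow> int" where
  "compl f t = t - f t"

lemma height_compl: "height (compl f) = int n - height f"
  by (simp add: compl_def height_def)

lemma counting_compl: "counting f \<Longrightarrow> counting (compl f)"
  using counting_step[of f] counting_period[of f]
  unfolding counting_def height_compl by (force simp: compl_def)

text \<open>\<open>compl\<close> lifts the complementary subset. Complementing and swapping preserve
  the difference and the comparison of heights, so the roles of \<open>R1\<close> and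
  \<open>R2\<close> are exchanged in \<open>R_compl\<close>.\<close>

lemma surplus_compl: "surplus (compl g) (compl f) = surplus f g"
  unfolding surplus_def height_compl by (simp add: compl_def)

lemma R_compl: "R1 (compl g) (compl f) = compl (R2 f g)" "R2 (compl g) (compl f) = compl (R1 f g)"
  unfolding R1_def R2_def surplus_compl by (auto simp: compl_def)

lemma compl_inject: "compl f = compl g \<Longrightarrow> f = g"
  by (simp add: compl_def fun_eq_iff)

text \<open>Two queues in series: the departures from the second are the minimum, over
  \<open>s <= u <= t\<close>, of the sum of arrivals up to \<open>s\<close>, services of
  \<open>g\<close> from \<open>s\<close> to \<open>u\<close> and services of \<open>h\<close> from
  \<open>u\<close> to \<open>t\<close>. The two clauses give attainment and the bound.\<close>

lemma tandem:
  assumes f: "counting f" and g: "counting g" and h: "counting h"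
    and "height f \<le> height g" "height f \<le> height h"
  shows "\<exists>s u. s \<le> u \<and> u \<le> t \<and> R2 (R2 f g) h t = f s - g s + g u - h u + h t"
    and "s \<le> u \<Longrightarrow> u \<le> t \<Longrightarrow> R2 (R2 f g) h t \<le> f s - g s + g u - h u + h t"
proof -
  let ?F = "R2 f g"
  have F: "counting ?F" "height ?F \<le> height h" using assms by (auto simp: counting_R)
  have eq: "R2 ?F h t = h t + past_min (\<lambda>s. ?F s - h s) t"
    "?F u = g u + past_min (\<lambda>s. f s - g s) u" for u
    using assms F by (auto simp: R2_def surplus_def)
  obtain u where u: "u \<le> t" "?F u - h u = past_min (\<lambda>s. ?F s - h s) t"
    using past_min_attained[of t "\<lambda>s. ?F s - h s"] by blast
  obtain s where s: "s \<le> u" "f s - g s = past_min (\<lambda>s. f s - g s) u"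
    using past_min_attained[of u "\<lambda>s. f s - g s"] by blast
  show "\<exists>s u. s \<le> u \<and> u \<le> t \<and> R2 (R2 f g) h t = f s - g s + g u - h u + h t"
    using u s eq(1) eq(2)[of u] by (intro exI[of _ s] exI[of _ u]) auto
  show "R2 ?F h t \<le> f s - g s + g u - h u + h t" if "s \<le> u" "u \<le> t" for s u
    using run_min_le[OF f g assms(4) that(1)] run_min_le[OF F(1) h F(2) that(2)] eq(1) eq(2)[of u] by simp
qed

text \<open>For fixed \<open>s\<close> and \<open>t\<close>, the minimum over \<open>u\<close> in
  the tandem formula is a window minimum of \<open>g - h\<close>. Passing to \<open>g - M\<close>
  and \<open>h + M\<close> replaces it by that of the Pitman transform, and the end terms
  \<open>- g s\<close> and \<open>h t\<close> contribute exactly the correction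
  \<open>M s + M t\<close>.\<close>

lemma R2_R2_sorted:
  assumes f: "counting f" and g: "counting g" and h: "counting h"
    and le: "height f \<le> height g" "height g \<le> height h"
  shows "R2 (R2 f g) h = R2 (R2 f (R1 g h)) (R2 g h)"
proof
  fix t
  let ?g = "R1 g h" and ?h = "R2 g h"
  define M where "M = past_min (\<lambda>s. g s - h s)"
  note gh = counting_R[OF g h]
  have M: "?g s = g s - M s" "?h s = h s + M s" for s
    using le by (auto simp: R1_def R2_def surplus_def M_def)
  have le': "height f \<le> height h" "height f \<le> height ?g" "height f \<le> height ?h"
    using le gh by auto
  note L = tandem[OF f g h le(1) le'(1), where t = t] and R = tandem[OF f gh(1) gh(3) le'(2,3), where t = t]
  show "R2 (R2 f g) h t = R2 (R2 f ?g) ?h t"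
  proof (rule order_antisym)
    obtain s u where su: "s \<le> u" "u \<le> t" "R2 (R2 f ?g) ?h t = f s - ?g s + ?g u - ?h u + ?h t"
      using R(1) by blast
    obtain r where "s \<le> r" "r \<le> t" "g r - h r \<le> g u - h u - 2 * M u + M s + M t"
      using pitman_window_ge[OF g h le(2) su(1,2)] M_def by auto
    then show "R2 (R2 f g) h t \<le> R2 (R2 f ?g) ?h t"
      using L(2)[of s r] su(3) M by simp
  next
    obtain s u where su: "s \<le> u" "u \<le> t" "R2 (R2 f g) h t = f s - g s + g u - h u + h t"
      using L(1) by blast
    obtain r where "s \<le> r" "r \<le> t" "g r - h r - 2 * M r + M s + M t \<le> g u - h u"
      using pitman_window_le[OF g h le(2) su(1,2)] M_def by auto
    then show "R2 (R2 f ?g) ?h t \<le> R2 (R2 f g) h t"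
      using R(2)[of s r] su(3) M by simp
  qed
qed

fun R12 where "R12 (f, g, h) = (R1 f g, R2 f g, h)"
fun R23 where "R23 (f, g, h) = (f, R1 g h, R2 g h)"

fun counting3 where "counting3 (f, g, h) \<longleftrightarrow> counting f \<and> counting g \<and> counting h"

lemma counting3_R: "counting3 x \<Longrightarrow> counting3 (R12 x)" "counting3 x \<Longrightarrow> counting3 (R23 x)"
  by (cases x; simp add: counting_R)+

lemma R3_involution: "counting3 x \<Longrightarrow> R12 (R12 x) = x" "counting3 x \<Longrightarrow> R23 (R23 x) = x"
  by (cases x; simp add: R_involution)+

definition braid where "braid x \<longleftrightarrow> R23 (R12 (R23 x)) = R12 (R23 (R12 x))"

lemma braid_sorted:
  assumes f: "counting f" and g: "counting g" and h: "counting h"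
    and le: "height f \<le> height g" "height g \<le> height h"
  shows "braid (f, g, h)"
proof -
  have 3: "R2 (R2 f (R1 g h)) (R2 g h) = R2 (R2 f g) h"
    using R2_R2_sorted[OF assms] by simp
  \<comment> \<open>Complementation reverses the order of heights, so the reversed complemented
    triple is again sorted; its last component is the complement of the first component of the
    original one.\<close>
  have "R2 (R2 (compl h) (compl g)) (compl f)
      = R2 (R2 (compl h) (R1 (compl g) (compl f))) (R2 (compl g) (compl f))"
    using le by (intro R2_R2_sorted counting_compl f g h) (auto simp: height_compl)
  then have 1: "R1 f (R1 g h) = R1 (R1 f g) (R1 (R2 f g) h)"
    unfolding R_compl by (rule compl_inject)
  \<comment> \<open>Every exchange preserves the pointwise sum of the triple, so the middle
    components agree once the outer ones do.\<close>
  have 2: "R1 (R2 f (R1 g h)) (R2 g h) = R2 (R1 f g) (R1 (R2 f g) h)"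
  proof
    fix t
    show "R1 (R2 f (R1 g h)) (R2 g h) t = R2 (R1 f g) (R1 (R2 f g) h) t"
      using R_sum[of "R2 f (R1 g h)" "R2 g h" t] R_sum[of f "R1 g h" t] R_sum[of g h t]
        R_sum[of "R1 f g" "R1 (R2 f g) h" t] R_sum[of "R2 f g" h t] R_sum[of f g t]
        fun_cong[OF 1, of t] fun_cong[OF 3, of t] by linarith
  qed
  show ?thesis by (simp add: braid_def 1 2 3)
qed

text \<open>Both generators are involutions: in the relation at \<open>R12 x\<close> a double
  \<open>R12\<close> cancels, and applying \<open>R23\<close> on the left gives the relation at
  \<open>x\<close>.\<close>

lemma braid_R12:
  assumes "counting3 x" "braid (R12 x)"
  shows "braid x"
proof -
  have "R23 (R12 (R23 (R12 x))) = R12 (R23 x)"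
    using assms by (simp add: braid_def R3_involution)
  from arg_cong[OF this, of R23] show ?thesis
    using assms(1) by (simp add: braid_def R3_involution counting3_R)
qed

lemma braid_R23:
  assumes "counting3 x" "braid (R23 x)"
  shows "braid x"
proof -
  have "R23 (R12 x) = R12 (R23 (R12 (R23 x)))"
    using assms by (simp add: braid_def R3_involution)
  from arg_cong[OF this, of R12] show ?thesis
    using assms(1) by (simp add: braid_def R3_involution counting3_R)
qed

text \<open>The exchanges generate an action of a dihedral group, and \<open>braid\<close> is constant on its
  orbits; since they permute the heights, every orbit contains a sorted triple.\<close>

lemma braid:
  assumes f: "counting f" and g: "counting g" and h: "counting h"
  shows "braid (f, g, h)"
proof -
  have *: "braid (f, g, h)"
    if f: "counting f" and g: "counting g" and h: "counting h" and fg: "height f \<le> height g" for f g h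
  proof (cases "height g \<le> height h")
    case True
    with that show ?thesis by (intro braid_sorted)
  next
    case gh: False
    note R = counting_R[OF g h]
    have "braid (f, R1 g h, R2 g h)"
    proof (cases "height f \<le> height h")
      case True
      with gh R f show ?thesis by (intro braid_sorted) auto
    next
      case False
      note R' = counting_R[OF f R(1)]
      \<comment> \<open>Here \<open>h\<close> has the smallest height and \<open>g\<close> the
        largest, so the heights are sorted after \<open>R23\<close> and \<open>R12\<close>.\<close>
      have "braid (R12 (f, R1 g h, R2 g h))"
        using False R R' f fg by (simp, intro braid_sorted) auto
      then show ?thesis using f R braid_R12[of "(f, R1 g h, R2 g h)"] by simp
    qed
    then show ?thesis using f g h braid_R23[of "(f, g, h)"] by simp
  qed
  show ?thesis
  proof (cases "height f \<le> height g")
    case False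
    then have "braid (R12 (f, g, h))" using counting_R[OF f g] h by (simp, intro *) auto
    then show ?thesis using f g h braid_R12[of "(f, g, h)"] by simp
  qed (use * f g h in blast)
qed

theorem R2_R2:
  assumes "counting f" "counting g" "counting h"
  shows "R2 (R2 f g) h = R2 (R2 f (R1 g h)) (R2 g h)"
  using braid[OF assms] by (simp add: braid_def)

subsection \<open>Subsets of the cycle\<close>

definition site :: "int \<Rightarrow> nat" where
  "site t = nat ((t - 1) mod int n) + 1"

lemma site_range [simp]: "site t \<in> {1..n}"
proof -
  have "0 \<le> (t - 1) mod int n" "(t - 1) mod int n < int n" using n_pos by auto
  then show ?thesis by (auto simp: site_def)
qed

lemma site_bounds [simp]: "Suc 0 \<le> site t" "site t \<le> n" "0 < site t"
  using site_range[of t] by auto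

lemma site_int [simp]: "i \<in> {1..n} \<Longrightarrow> site (int i) = i"
  by (auto simp: site_def)

lemma site_eq_iff: "site s = site t \<longleftrightarrow> (s - t) mod int n = 0"
proof -
  have "site s = site t \<longleftrightarrow> (s - 1) mod int n = (t - 1) mod int n"
    using n_pos by (simp add: site_def nat_eq_iff)
  also have "\<dots> \<longleftrightarrow> int n dvd (s - 1) - (t - 1)" by (rule mod_eq_dvd_iff)
  finally show ?thesis by (simp add: dvd_eq_mod_eq_0)
qed

lemma int_site: "\<exists>m. t = int (site t) + m * int n"
proof -
  have "site (int (site t)) = site t" by (rule site_int) simp
  then have "(t - int (site t)) mod int n = 0" by (metis site_eq_iff)
  then obtain m where "t - int (site t) = int n * m" by (auto simp: mod_eq_0_iff_dvd elim: dvdE)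
  then show ?thesis by (intro exI[of _ m]) (simp add: algebra_simps)
qed

lemma periodic_multiple:
  assumes "\<And>t. F (t + int n) = F t"
  shows "F (t + m * int n) = F t"
proof (induction m rule: int_induct[where k = 0])
  case (step1 i)
  then show ?case using assms[of "t + i * int n"] by (simp add: algebra_simps)
next
  case (step2 i)
  then show ?case using assms[of "t + (i - 1) * int n"] by (simp add: algebra_simps)
qed simp

lemma periodic_site:
  assumes "\<And>t. F (t + int n) = F t"
  shows "F t = F (int (site t))"
  using int_site[of t] periodic_multiple[of F, OF assms] by metis

lemma right_site_site: "right_site n (site t) = site (t + 1)"
proof (cases "(t - 1) mod int n = int n - 1")
  case True
  then have "site t = n" using n_pos by (simp add: site_def)
  moreover have "t mod int n = 0" using True
    by (metis add.commute diff_add_cancel mod_add_left_eq mod_self)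
  ultimately show ?thesis by (simp add: site_def right_site_def)
next
  case False
  have "0 \<le> (t - 1) mod int n" "(t - 1) mod int n < int n" using n_pos by auto
  with False have *: "(t - 1) mod int n + 1 < int n" by simp
  have "t mod int n = ((t - 1) mod int n + 1) mod int n" by (simp add: mod_add_left_eq)
  also have "\<dots> = (t - 1) mod int n + 1" using * n_pos by (intro mod_pos_pos_trivial) auto
  finally have "t mod int n = (t - 1) mod int n + 1" .
  moreover have "nat ((t - 1) mod int n + 1) = Suc (nat ((t - 1) mod int n))"
    using n_pos by (simp add: nat_add_distrib)
  ultimately show ?thesis using * by (auto simp: site_def right_site_def)
qed

lemma left_right_site: "i \<in> {1..n} \<Longrightarrow> left_site n (right_site n i) = i"
  by (auto simp: left_site_def right_site_def)

lemma left_site_site: "left_site n (site t) = site (t - 1)"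
  using left_right_site[of "site (t - 1)"] right_site_site[of "t - 1"] by simp

definition support :: "(int \<Rightarrow> int) \<Rightarrow> nat set" where
  "support f = {i \<in> {1..n}. f (int i) - f (int i - 1) = 1}"

text \<open>The lift of \<open>S\<close> normalised by \<open>counter S 0 = 0\<close>: full periods
  from the quotient, a partial one from the remainder. Up to additive constants it is inverse to
  \<open>support\<close>.\<close>

definition counter :: "nat set \<Rightarrow> int \<Rightarrow> int" where
  "counter S t = int (card S) * (t div int n) + int (card (S \<inter> {1..nat (t mod int n)}))"

lemma counting_increment:
  assumes "counting f"
  shows "f t - f (t - 1) = of_bool (site t \<in> support f)"
proof -
  have "f (r + int n) - f (r + int n - 1) = f r - f (r - 1)" for r
    using counting_period[OF assms, of r] counting_period[OF assms, of "r - 1"]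
    by (simp add: algebra_simps)
  from periodic_site[of "\<lambda>t. f t - f (t - 1)", OF this]
  have "f t - f (t - 1) = f (int (site t)) - f (int (site t) - 1)" .
  then show ?thesis using counting_step[OF assms, of "int (site t) - 1"]
    unfolding support_def by (auto simp: of_bool_def)
qed

lemma support_unique:
  assumes "S \<subseteq> {1..n}" "\<And>t. f t - f (t - 1) = of_bool (site t \<in> S)"
  shows "support f = S"
  using assms by (auto simp: support_def)

lemma counter_increment:
  assumes S: "S \<subseteq> {1..n}"
  shows "counter S t - counter S (t - 1) = of_bool (site t \<in> S)"
proof -
  define r where "r = (t - 1) mod int n"
  define d where "d = (t - 1) div int n"
  have r: "0 \<le> r" "r < int n" using n_pos by (auto simp: r_def)
  have t: "t = int n * d + r + 1" using mult_div_mod_eq[of "int n" "t - 1"] unfolding r_def d_def by linarith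
  have fin: "finite S" using S finite_subset by blast
  have s: "site t = nat r + 1" by (simp add: site_def r_def)
  have ins: "S \<inter> {1..Suc k} = (if Suc k \<in> S then insert (Suc k) (S \<inter> {1..k}) else S \<inter> {1..k})" for k
    by (auto simp: le_Suc_eq)
  show ?thesis
  proof (cases "r + 1 < int n")
    case True
    then have "t div int n = d" "t mod int n = r + 1"
      using r n_pos unfolding t by (simp_all add: add.assoc)
    moreover have "nat (r + 1) = Suc (nat r)" using r by simp
    ultimately show ?thesis
      using fin ins[of "nat r"] by (simp add: counter_def s flip: r_def d_def)
  next
    case False
    then have t': "t = int n * (d + 1)" using r t by (simp add: algebra_simps)
    then have td: "t div int n = d + 1" "t mod int n = 0" using n_pos by simp_all
    have "Suc (nat r) = n" using False r by linarith
    then have "S = S \<inter> {1..Suc (nat r)}" using S by auto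
    moreover have "card (S \<inter> {1..Suc (nat r)}) = card (S \<inter> {1..nat r}) + of_bool (Suc (nat r) \<in> S)"
      unfolding ins using fin by simp
    ultimately have "card S = card (S \<inter> {1..nat r}) + of_bool (Suc (nat r) \<in> S)" by simp
    with td show ?thesis
      by (simp add: counter_def s algebra_simps flip: r_def d_def)
  qed
qed

lemma height_counter: "height (counter S) = int (card S)"
  using n_pos by (simp add: height_def counter_def)

lemma counting_counter:
  assumes "S \<subseteq> {1..n}"
  shows "counting (counter S)"
proof -
  have "counter S (t + 1) = counter S t \<or> counter S (t + 1) = counter S t + 1" for t
    using counter_increment[OF assms, of "t + 1"] by (cases "site (t + 1) \<in> S") auto
  moreover have "counter S (t + int n) = counter S t + height (counter S)" for t
    using n_pos unfolding height_counter by (simp add: counter_def div_add_self2 distrib_left)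
  ultimately show ?thesis by (simp add: counting_def)
qed

lemma support_counter: "S \<subseteq> {1..n} \<Longrightarrow> support (counter S) = S"
  by (intro support_unique counter_increment)

lemma support_subset: "support f \<subseteq> {1..n}"
  by (auto simp: support_def)

lemma counting_eq_counter:
  assumes "counting f"
  shows "f t = counter (support f) t + f 0"
proof (induction t rule: int_induct[where k = 0])
  case base
  show ?case by (simp add: counter_def)
next
  case (step1 i)
  then show ?case using counting_increment[OF assms, of "i + 1"]
      counter_increment[OF support_subset, of f "i + 1"] by simp
next
  case (step2 i)
  then show ?case using counting_increment[OF assms, of i]
      counter_increment[OF support_subset, of f i] by simp
qed

lemma card_support: "counting f \<Longrightarrow> int (card (support f)) = height f"
  using counting_eq_counter[of f "int n"] counting_eq_counter[of f 0] height_counter[of "support f"]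
  by (simp add: height_def)

lemma past_min_add: "past_min (\<lambda>s. W s + c) t = past_min W t + c"
  unfolding past_min_def by (rule Min_add_commute) auto

lemma future_min_add: "future_min (\<lambda>s. W s + c) t = future_min W t + c"
  unfolding future_min_def by (rule Min_add_commute) auto

lemma surplus_add: "surplus (\<lambda>t. f t + a) (\<lambda>t. g t + b) t = surplus f g t + (a - b)"
proof -
  have "(\<lambda>s. f s + a - (g s + b)) = (\<lambda>s. f s - g s + (a - b))" by auto
  then show ?thesis by (simp only: surplus_def past_min_add future_min_add) (simp add: height_def past_min_add future_min_add)
qed

section \<open>The exchange on pairs of subsets of the cycle\<close>

definition set_R1 :: "nat set \<Rightarrow> nat set \<Rightarrow> nat set" where
  "set_R1 A B = support (R1 (counter A) (counter B))"

definition set_R2 :: "nat set \<Rightarrow> nat set \<Rightarrow> nat set" where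
  "set_R2 A B = support (R2 (counter A) (counter B))"

text \<open>Additive constants in \<open>f\<close> and \<open>g\<close> shift the surplus by a
  constant only, so the supports of the results depend only on the supports of the
  arguments.\<close>

lemma support_R:
  assumes "counting f" "counting g"
  shows "support (R1 f g) = set_R1 (support f) (support g)" "support (R2 f g) = set_R2 (support f) (support g)"
proof -
  let ?F = "counter (support f)" and ?G = "counter (support g)"
  have eq: "f = (\<lambda>t. ?F t + f 0)" "g = (\<lambda>t. ?G t + g 0)"
    using assms counting_eq_counter by blast+
  have s: "surplus f g t = surplus ?F ?G t + (f 0 - g 0)" for t
    by (subst eq(1), subst eq(2)) (rule surplus_add)
  have "R1 f g t = R1 ?F ?G t + g 0" "R2 f g t = R2 ?F ?G t + f 0" for t
    unfolding R1_def R2_def s using fun_cong[OF eq(1), of t] fun_cong[OF eq(2), of t] by simp_all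
  then show "support (R1 f g) = set_R1 (support f) (support g)"
    "support (R2 f g) = set_R2 (support f) (support g)"
    by (simp_all add: set_R1_def set_R2_def support_def)
qed

lemma set_R_subset: "set_R1 A B \<subseteq> {1..n}" "set_R2 A B \<subseteq> {1..n}"
  unfolding set_R1_def set_R2_def by (rule support_subset)+

context
  fixes A B
  assumes A: "A \<subseteq> {1..n}" and B: "B \<subseteq> {1..n}"
begin

lemma counting_counter_A: "counting (counter A)" and counting_counter_B: "counting (counter B)"
  using A B counting_counter by auto

lemma set_R_card: "card (set_R1 A B) = card B" "card (set_R2 A B) = card A"
  using card_support[OF counting_R(1)[OF counting_counter_A counting_counter_B]] card_support[OF counting_R(3)[OF counting_counter_A counting_counter_B]]
  by (simp_all add: set_R1_def set_R2_def counting_R counting_counter_A counting_counter_B height_counter)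

lemma set_R_involution: "set_R1 (set_R1 A B) (set_R2 A B) = A" "set_R2 (set_R1 A B) (set_R2 A B) = B"
  unfolding set_R1_def[of A] set_R2_def[of A] support_R[OF counting_R(1,3)[OF counting_counter_A counting_counter_B], symmetric]
    R_involution[OF counting_counter_A counting_counter_B] by (simp_all only: support_counter A B)

text \<open>Taking increments in \<open>R_sum\<close> gives conservation site by site; this is what
  makes the exchange preserve weights.\<close>

lemma set_R_sum:
  "(of_bool (i \<in> set_R1 A B) :: nat) + of_bool (i \<in> set_R2 A B) = of_bool (i \<in> A) + of_bool (i \<in> B)"
proof (cases "i \<in> {1..n}")
  case True
  let ?a = "counter A" and ?b = "counter B"
  have c: "counting (R1 ?a ?b)" "counting (R2 ?a ?b)"
    by (simp_all add: counting_R counting_counter_A counting_counter_B)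
  have "(of_bool (i \<in> set_R1 A B) :: int) + of_bool (i \<in> set_R2 A B) = of_bool (i \<in> A) + of_bool (i \<in> B)"
    using counting_increment[OF c(1), of "int i"] counting_increment[OF c(2), of "int i"]
      counter_increment[OF A, of "int i"] counter_increment[OF B, of "int i"]
      R_sum[of ?a ?b "int i"] R_sum[of ?a ?b "int i - 1"] True
    unfolding set_R1_def set_R2_def by simp
  then show ?thesis by (auto split: if_splits simp: of_bool_def)
next
  case False
  then show ?thesis using A B set_R_subset[of A B] by auto
qed

text \<open>The running minimum never rises, so \<open>g + M\<close> can step only where
  \<open>g\<close> does: departures use service times.\<close>

lemma set_R2_subset:
  assumes "card A \<le> card B"
  shows "set_R2 A B \<subseteq> B"
proof
  fix i assume i: "i \<in> set_R2 A B"
  then have i': "i \<in> {1..n}" using set_R_subset by blast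
  let ?a = "counter A" and ?b = "counter B"
  have h: "height ?a \<le> height ?b" using assms by (simp add: height_counter)
  have "?b (int i) - ?b (int i - 1) = 1"
    using i run_min_step[OF counting_counter[OF A] counting_counter[OF B] h, of "int i - 1"] h
      counting_step[OF counting_counter[OF B], of "int i - 1"]
    by (auto simp: set_R2_def support_def R2_def surplus_def)
  then show "i \<in> B" using counter_increment[OF B, of "int i"] i' by (auto split: if_splits)
qed

lemma set_R2_same_card: "card A = card B \<Longrightarrow> set_R2 A B = B"
  using set_R2_subset set_R_card(2) B finite_subset[OF B] by (metis card_subset_eq finite_atLeastAtMost order_refl)

end

lemma set_R2_set_R2:
  assumes "A \<subseteq> {1..n}" "B \<subseteq> {1..n}" "C \<subseteq> {1..n}"
  shows "set_R2 (set_R2 A B) C = set_R2 (set_R2 A (set_R1 B C)) (set_R2 B C)"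
proof -
  note c = counting_counter[OF assms(1)] counting_counter[OF assms(2)] counting_counter[OF assms(3)]
  from arg_cong[OF R2_R2[OF c], of support] show ?thesis
    by (simp only: support_R counting_R c support_counter assms)
qed

subsection \<open>Greedy matching\<close>

text \<open>\<open>X t\<close> is the number of letters that are carried from site \<open>t\<close> to the next site in direction \<open>e\<close>
  when the letters on \<open>T\<close> fill the sites \<open>S\<close>.\<close>

definition matching :: "int \<Rightarrow> nat set \<Rightarrow> nat set \<Rightarrow> nat set \<Rightarrow> (int \<Rightarrow> int) \<Rightarrow> bool" where
  "matching e T Q S X \<longleftrightarrow> (\<forall>t. X t \<ge> 0) \<and> (\<forall>t. X (t + int n) = X t) \<and>
     (\<forall>t. X t - X (t - e) = of_bool (site t \<in> T) - of_bool (site t \<in> S)) \<and>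
     (\<forall>t. site t \<in> Q - S \<longrightarrow> X t = 0)"

text \<open>The indicator of the residues below \<open>k\<close> steps up at 0 and down at
  \<open>k\<close>: it is the flow of one letter carried over \<open>k\<close> links.\<close>

lemma mod_window:
  assumes "0 \<le> k" "k < int n"
  shows "(of_bool (y mod int n < k) :: int) - of_bool ((y - 1) mod int n < k)
    = of_bool (y mod int n = 0) - of_bool (y mod int n = k)"
proof -
  define r where "r = (y - 1) mod int n"
  have r: "0 \<le> r" "r < int n" using n_pos by (auto simp: r_def)
  have "y mod int n = (r + 1) mod int n" by (simp add: r_def mod_add_left_eq)
  also have "\<dots> = (if r + 1 = int n then 0 else r + 1)"
    using r by auto
  finally show ?thesis using assms r unfolding r_def[symmetric] by auto
qed

text \<open>The letter at \<open>i\<close> travels to the first free site \<open>k\<close> and adds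
  one to the flow on each link before \<open>k\<close>. All sites passed are outside
  \<open>Q\<close> or already filled, so the flow still vanishes at the sites left free. The sign
  \<open>e\<close> is the direction of travel.\<close>

lemma matching_insert:
  assumes e: "e = 1 \<or> e = - 1" and step: "\<And>t. step (site t) = site (t + e)"
    and m: "matching e T Q S X" and i: "i \<in> {1..n}" "i \<notin> T"
    and free: "j \<in> Q \<inter> {1..n} - S"
  defines "k \<equiv> first_site step (\<lambda>j. j \<in> Q \<and> j \<notin> S) i"
  shows "k \<in> Q \<inter> {1..n} - S" "\<exists>X'. matching e (insert i T) Q (insert k S) X'"
proof -
  have it: "(step ^^ m) i = site (int i + e * int m)" for m
  proof (induction m)
    case 0
    show ?case using i by simp
  next
    case (Suc m)
    then show ?case by (simp add: step algebra_simps)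
  qed
  define P where "P = (\<lambda>m. site (int i + e * int m) \<in> Q - S)"
  define K where "K = (LEAST m. P m)"
  \<comment> \<open>The number of steps from \<open>i\<close> to the free site \<open>j\<close>; it
    bounds the search, so that \<open>K < n\<close>.\<close>
  define m0 where "m0 = nat ((e * (int j - int i)) mod int n)"
  have m0: "int m0 = (e * (int j - int i)) mod int n" "m0 < n"
    using n_pos by (auto simp: m0_def nat_less_iff)
  have "(int i + e * int m0 - int j) mod int n = 0"
  proof -
    obtain c where "e * (int j - int i) = int m0 + int n * c"
      using m0(1) by (metis add.commute mult_div_mod_eq)
    then have "int i + e * int m0 - int j = int n * (- (e * c))"
      using e by (auto simp: algebra_simps)
    then show ?thesis by simp
  qed
  then have "site (int i + e * int m0) = site (int j)" by (simp add: site_eq_iff)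
  then have "P m0" using free by (simp add: P_def)
  then have K: "P K" "K < n" "\<And>m. P m \<Longrightarrow> K \<le> m"
    using LeastI[of P] Least_le[of P] m0(2) unfolding K_def by (auto intro: le_less_trans)
  have k: "k = site (int i + e * int K)"
    unfolding k_def first_site_def it K_def P_def by simp
  show "k \<in> Q \<inter> {1..n} - S" using K(1) unfolding P_def k by simp
  define G where "G = (\<lambda>t. of_bool ((e * (t - int i)) mod int n < int K) :: int)"
  have ki: "site t = i \<longleftrightarrow> (e * (t - int i)) mod int n = 0" for t
  proof -
    have "site t = i \<longleftrightarrow> site t = site (int i)" using i by simp
    also have "\<dots> \<longleftrightarrow> (t - int i) mod int n = 0" by (rule site_eq_iff)
    finally show ?thesis using e by (auto simp: mod_eq_0_iff_dvd dvd_diff_commute)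
  qed
  have kk: "site t = site (int i + e * int m) \<longleftrightarrow> (e * (t - int i)) mod int n = int m" if "m < n" for t m
  proof -
    have "site t = site (int i + e * int m) \<longleftrightarrow> int n dvd t - (int i + e * int m)"
      by (simp add: site_eq_iff mod_eq_0_iff_dvd)
    also have "\<dots> \<longleftrightarrow> int n dvd e * (t - (int i + e * int m))" using e by (auto simp: dvd_diff_commute)
    also have "e * (t - (int i + e * int m)) = e * (t - int i) - int m"
      using e by (auto simp: algebra_simps)
    also have "int n dvd \<dots> \<longleftrightarrow> (e * (t - int i)) mod int n = int m mod int n"
      by (simp add: mod_eq_dvd_iff)
    finally show ?thesis using that by simp
  qed
  have "matching e (insert i T) Q (insert k S) (\<lambda>t. X t + G t)"
    unfolding matching_def
  proof (intro conjI allI impI)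
    fix t
    show "0 \<le> X t + G t" using m by (simp add: matching_def G_def)
    have "e * (t + int n - int i) = e * (t - int i) + int n * e" by (simp add: algebra_simps)
    then have "G (t + int n) = G t" unfolding G_def by simp
    then show "X (t + int n) + G (t + int n) = X t + G t" using m by (simp add: matching_def)
    have "e * (t - e - int i) = e * (t - int i) - 1" using e by auto
    then have "G t - G (t - e) = of_bool (site t = i) - of_bool (site t = k)"
      unfolding G_def ki k kk[OF K(2)] using mod_window[of "int K"] K(2) by simp
    moreover have "X t - X (t - e) = of_bool (site t \<in> T) - of_bool (site t \<in> S)"
      using m by (simp add: matching_def)
    moreover have "k \<notin> S" using K(1) unfolding P_def k by simp
    ultimately show "X t + G t - (X (t - e) + G (t - e))
        = of_bool (site t \<in> insert i T) - of_bool (site t \<in> insert k S)"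
      using i(2) by auto
  next
    fix t assume t: "site t \<in> Q - insert k S"
    then have "X t = 0" using m by (simp add: matching_def)
    moreover have "G t = 0"
    proof (rule ccontr)
      assume "G t \<noteq> 0"
      then have less: "(e * (t - int i)) mod int n < int K" by (simp add: G_def)
      define l where "l = nat ((e * (t - int i)) mod int n)"
      have l: "int l = (e * (t - int i)) mod int n" using n_pos by (simp add: l_def)
      then have "l < K" using less by simp
      then have "site t = site (int i + e * int l)" using kk[of l t] l K(2) by simp
      then have "P l" using t by (simp add: P_def)
      with K(3) \<open>l < K\<close> show False by fastforce
    qed
    ultimately show "X t + G t = 0" by simp
  qed
  then show "\<exists>X'. matching e (insert i T) Q (insert k S) X'" by blast
qed

lemma counting_flow:
  assumes A: "A \<subseteq> {1..n}" and S: "S \<subseteq> {1..n}"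
    and per: "\<And>t. X (t + int n) = X t"
    and flow: "\<And>t. X t - X (t - 1) = of_bool (site t \<in> A) - of_bool (site t \<in> S)"
  defines "d \<equiv> \<lambda>t. counter A t - X t"
  shows "d t - d (t - 1) = of_bool (site t \<in> S)" "support d = S"
proof -
  show *: "d t - d (t - 1) = of_bool (site t \<in> S)" for t
    using flow[of t] counter_increment[OF A, of t] by (simp add: d_def)
  show "support d = S" by (intro support_unique S *)
qed

text \<open>\<open>d\<close> counts the filled sites. \<open>d - g\<close> is antimonotone because
  \<open>S\<close> lies in \<open>Q\<close>, is at most \<open>f - g\<close> because the flow is
  nonnegative, and meets \<open>f - g\<close> at the free sites of \<open>Q\<close>, between which
  it is constant. So it is the running minimum of \<open>f - g\<close>. If no site is free,
  cardinality settles the claim.\<close>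

lemma matching_right:
  assumes m: "matching 1 A Q S X" and A: "A \<subseteq> {1..n}" and Q: "Q \<subseteq> {1..n}" and S: "S \<subseteq> Q"
    and card: "card S = card A"
  shows "set_R2 A Q = S"
proof (cases "S = Q")
  case True
  then show ?thesis using set_R2_same_card[OF A Q] card by simp
next
  case False
  then obtain j where j: "j \<in> Q - S" using S by blast
  have Q': "finite Q" using Q finite_subset by blast
  have cle: "card A \<le> card Q" using card card_mono[OF Q' S] by simp
  define f where "f = counter A"
  define g where "g = counter Q"
  define d where "d = (\<lambda>t. f t - X t)"
  have per: "X (t + int n) = X t" and pos: "X t \<ge> 0"
    and flow: "X t - X (t - 1) = of_bool (site t \<in> A) - of_bool (site t \<in> S)"
    and zero: "site t \<in> Q - S \<Longrightarrow> X t = 0" for t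
    using m unfolding matching_def by auto
  have S': "S \<subseteq> {1..n}" using S Q by blast
  have d: "d t - d (t - 1) = of_bool (site t \<in> S)" "support d = S" for t
    unfolding d_def f_def using counting_flow[OF A S' per flow] by simp_all
  have gi: "g t - g (t - 1) = of_bool (site t \<in> Q)" for t
    unfolding g_def by (rule counter_increment[OF Q])
  have cf: "counting f" "counting g" unfolding f_def g_def using A Q counting_counter by auto
  have h: "height f \<le> height g" using cle by (simp add: f_def g_def height_counter)
  have mono: "d t - g t \<le> d s - g s" if "s \<le> t" for s t using that
  proof (induction t rule: int_ge_induct)
    case (step t)
    have "d (t + 1) - d t \<le> g (t + 1) - g t"
      using d(1)[of "t + 1"] gi[of "t + 1"] S by auto
    with step.IH show ?case by simp
  qed simp
  have att: "\<exists>s\<le>t. f s - g s = d t - g t" for t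
  proof -
    \<comment> \<open>The induction starts at a lift \<open>t0 <= t\<close> of the free site
      \<open>j\<close>, where the flow vanishes.\<close>
    define c where "c = \<bar>t\<bar> + int j"
    define t0 where "t0 = int j - c * int n"
    have "c * 1 \<le> c * int n" using n_pos by (intro mult_left_mono) (auto simp: c_def)
    moreover have "int j - c \<le> t" by (simp add: c_def)
    ultimately have "t0 \<le> t" unfolding t0_def by simp
    have "site t0 = site (int j)" by (simp add: site_eq_iff t0_def)
    then have t0: "site t0 \<in> Q - S" using j Q by auto
    show ?thesis using \<open>t0 \<le> t\<close>
    proof (induction t rule: int_ge_induct)
      case base
      then show ?case using zero[OF t0] by (auto simp: d_def)
    next
      case (step t)
      show ?case
      proof (cases "site (t + 1) \<in> Q - S")
        case True
        then show ?thesis using zero[OF True] by (auto simp: d_def)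
      next
        case False
        then have "d (t + 1) - g (t + 1) = d t - g t"
          using d(1)[of "t + 1"] gi[of "t + 1"] S by (cases "site (t + 1) \<in> S") auto
        moreover obtain s where "s \<le> t" "f s - g s = d t - g t" using step.IH by blast
        ultimately show ?thesis by (intro exI[of _ s]) simp
      qed
    qed
  qed
  have "past_min (\<lambda>s. f s - g s) t = d t - g t" for t
  proof -
    obtain s where "s \<le> t" "f s - g s = d t - g t" using att by blast
    then show ?thesis
    proof (intro past_min_eqI[of "\<lambda>s. f s - g s"])
      show "f (t + int n) - g (t + int n) \<le> f t - g t" for t
        using diff_drift[OF cf h] .
      show "d t - g t \<le> f s - g s" if "s \<le> t" for s
        using mono[OF that] pos[of s] by (simp add: d_def)
    qed
  qed
  then have "R2 f g = d" using h by (auto simp: R2_def surplus_def)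
  then show ?thesis using d(2) by (simp add: set_R2_def f_def g_def)
qed

text \<open>Phase I in complements: letters off \<open>A\<close> travel left to sites off
  \<open>Q\<close> and fill those off \<open>S\<close>. This mirrors \<open>matching_right\<close>,
  with the minimum over the future.\<close>

lemma matching_left:
  assumes m: "matching (- 1) ({1..n} - A) ({1..n} - Q) ({1..n} - S) X"
    and A: "A \<subseteq> {1..n}" and S': "S \<subseteq> {1..n}" and Q: "Q \<subseteq> S"
    and card: "card S = card A"
  shows "set_R2 A Q = S"
proof (cases "S = Q")
  case True
  then show ?thesis using set_R2_same_card[OF A] S' card by simp
next
  case False
  then obtain j where j: "j \<in> S - Q" using Q by blast
  have Q': "Q \<subseteq> {1..n}" using Q S' by blast
  have "card Q < card S" using False Q finite_subset[OF S'] by (simp add: psubset_card_mono)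
  then have cle: "card Q < card A" using card by simp
  define f where "f = counter A"
  define g where "g = counter Q"
  \<comment> \<open>\<open>X (t + 1)\<close> letters cross from \<open>t + 1\<close> to
    \<open>t\<close>. Shifted by one and read in complements, this satisfies the rightward flow
    equation for \<open>A\<close> and \<open>S\<close>.\<close>
  define Y where "Y = (\<lambda>t. X (t + 1))"
  define d where "d = (\<lambda>t. f t - Y t)"
  have "X (t + 1 + int n) = X (t + 1)" for t
    using m unfolding matching_def by blast
  moreover have "t + int n + 1 = t + 1 + int n" for t by simp
  ultimately have pos: "Y t \<ge> 0" and per: "Y (t + int n) = Y t" for t
    using m unfolding matching_def Y_def by (simp_all only:)
  have flow: "Y t - Y (t - 1) = of_bool (site t \<in> A) - of_bool (site t \<in> S)" for t
  proof -
    have "X t - X (t + 1) = of_bool (site t \<notin> A) - of_bool (site t \<notin> S)"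
      using m by (simp add: matching_def)
    then show ?thesis by (auto simp: Y_def split: if_splits)
  qed
  have zero: "site (t + 1) \<in> S - Q \<Longrightarrow> Y t = 0" for t
    using m unfolding matching_def Y_def by auto
  have d: "d t - d (t - 1) = of_bool (site t \<in> S)" "support d = S" for t
    unfolding d_def f_def using counting_flow[OF A S' per flow] by simp_all
  have gi: "g t - g (t - 1) = of_bool (site t \<in> Q)" for t
    unfolding g_def by (rule counter_increment[OF Q'])
  have cf: "counting f" "counting g" unfolding f_def g_def using A Q' counting_counter by auto
  have h: "height g < height f" using cle by (simp add: f_def g_def height_counter)
  have mono: "d s - g s \<le> d t - g t" if "s \<le> t" for s t using that
  proof (induction t rule: int_ge_induct)
    case (step t)
    have "d (t + 1) - d t \<ge> g (t + 1) - g t"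
      using d(1)[of "t + 1"] gi[of "t + 1"] Q by auto
    with step.IH show ?case by simp
  qed simp
  have att: "\<exists>s\<ge>t. f s - g s = d t - g t" for t
  proof -
    define c where "c = \<bar>t\<bar> + 1"
    define t0 where "t0 = int j + c * int n"
    have "c * 1 \<le> c * int n" using n_pos by (intro mult_left_mono) (auto simp: c_def)
    moreover have "t \<le> c - 1" by (simp add: c_def)
    ultimately have "t \<le> t0 - 1" unfolding t0_def by simp
    have "site t0 = site (int j)" by (simp add: site_eq_iff t0_def)
    then have t0: "site (t0 - 1 + 1) \<in> S - Q" using j S' by auto
    show ?thesis using \<open>t \<le> t0 - 1\<close>
    proof (induction t rule: int_le_induct)
      case base
      then show ?case using zero[OF t0] by (auto simp: d_def)
    next
      case (step t)
      show ?case
      proof (cases "site t \<in> S - Q")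
        case True
        then show ?thesis using zero[of "t - 1"] by (intro exI[of _ "t - 1"]) (auto simp: d_def)
      next
        case False
        then have "d (t - 1) - g (t - 1) = d t - g t"
          using d(1)[of t] gi[of t] Q by (cases "site t \<in> Q") auto
        moreover obtain s where "t \<le> s" "f s - g s = d t - g t" using step.IH by blast
        ultimately show ?thesis by (intro exI[of _ s]) simp
      qed
    qed
  qed
  have "future_min (\<lambda>s. f s - g s) t = d t - g t" for t
  proof -
    obtain s where "t \<le> s" "f s - g s = d t - g t" using att by blast
    then show ?thesis
    proof (intro future_min_eqI[of "\<lambda>s. f s - g s"])
      show "f t - g t \<le> f (t + int n) - g (t + int n)" for t
        using counting_period[OF cf(1), of t] counting_period[OF cf(2), of t] h by simp
      show "d t - g t \<le> f s - g s" if "t \<le> s" for s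
        using mono[OF that] pos[of s] by (simp add: d_def)
    qed
  qed
  then have "R2 f g = d" using h by (auto simp: R2_def surplus_def)
  then show ?thesis using d(2) by (simp add: set_R2_def f_def g_def)
qed

subsection \<open>Level sets of words\<close>

definition put :: "(nat \<Rightarrow> nat) \<Rightarrow> nat set \<Rightarrow> (nat \<Rightarrow> nat) \<Rightarrow> nat \<Rightarrow> (nat \<rightharpoonup> nat) \<Rightarrow> (nat \<rightharpoonup> nat)" where
  "put step Q h i v = v(first_site step (\<lambda>j. j \<in> Q \<and> j \<notin> dom v) i \<mapsto> h i)"

lemma phase_put:
  "phaseI_step n q u = put (left_site n) (- q) (\<lambda>i. u i + 1)"
  "phaseII_step n q u = put (right_site n) q u"
  by (auto simp: fun_eq_iff phaseI_step_def phaseII_step_def put_def)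

definition filled :: "nat set \<Rightarrow> (nat \<Rightarrow> bool) \<Rightarrow> (nat \<rightharpoonup> nat) \<Rightarrow> nat set" where
  "filled Q P v = {j \<in> Q. \<exists>y. v j = Some y \<and> P y}"

text \<open>\<open>P\<close> is meant as a threshold on letters. Those satisfying it are placed
  before all others, so the sites they take form a greedy matching by themselves, which later
  letters do not disturb.\<close>

lemma fold_put:
  assumes e: "e = 1 \<or> e = - 1" and step: "\<And>t. step (site t) = site (t + e)"
    and v0: "dom v0 \<inter> Q = {}"
  shows "distinct xs \<Longrightarrow> set xs \<subseteq> {1..n} \<Longrightarrow> length xs \<le> card (Q \<inter> {1..n}) \<Longrightarrow>
    sorted_wrt (\<lambda>i j. P (h j) \<longrightarrow> P (h i)) xs \<Longrightarrow> v = fold (put step Q h) xs v0 \<Longrightarrow>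
    (\<forall>j. j \<notin> Q \<longrightarrow> v j = v0 j) \<and> (\<forall>j\<in>Q. \<forall>y. v j = Some y \<longrightarrow> y \<in> h ` set xs) \<and>
    dom v \<inter> Q \<subseteq> {1..n} \<and> card (dom v \<inter> Q) = length xs \<and>
    (\<exists>X. matching e (set xs) Q (dom v \<inter> Q) X) \<and>
    (\<exists>X. matching e {i \<in> set xs. P (h i)} Q (filled Q P v) X) \<and>
    card (filled Q P v) = card {i \<in> set xs. P (h i)}"
proof (induction xs arbitrary: v rule: rev_induct)
  case Nil
  have "filled Q P v0 = {}" using v0 by (auto simp: filled_def)
  moreover have "matching e {} Q {} (\<lambda>_. 0)" by (simp add: matching_def)
  ultimately show ?case using Nil v0 by auto
next
  case (snoc i xs)
  define w where "w = fold (put step Q h) xs v0"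
  define S where "S = dom w \<inter> Q"
  define k where "k = first_site step (\<lambda>j. j \<in> Q \<and> j \<notin> S) i"
  have prems: "distinct xs" "set xs \<subseteq> {1..n}" "length xs \<le> card (Q \<inter> {1..n})"
    "sorted_wrt (\<lambda>i j. P (h j) \<longrightarrow> P (h i)) xs"
    using snoc.prems by (auto simp: sorted_wrt_append)
  note IH = snoc.IH[OF prems w_def]
  obtain X where X: "matching e (set xs) Q S X" using IH S_def by blast
  have S: "S \<subseteq> {1..n}" "card S = length xs" "finite S"
    using IH finite_subset[of S "{1..n}"] by (auto simp: S_def)
  have "card S < card (Q \<inter> {1..n})" using snoc.prems(3) S by simp
  then obtain j where j: "j \<in> Q \<inter> {1..n} - S"
    using card_mono[OF S(3), of "Q \<inter> {1..n}"] by (meson Diff_iff not_less subsetI)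
  have i: "i \<in> {1..n}" "i \<notin> set xs" using snoc.prems(1,2) by auto
  note ins = matching_insert[OF e step X i j, folded k_def]
  have v: "v = w(k \<mapsto> h i)"
  proof -
    have "(\<lambda>j. j \<in> Q \<and> j \<notin> dom w) = (\<lambda>j. j \<in> Q \<and> j \<notin> S)" by (auto simp: S_def)
    moreover have "v = put step Q h i w" by (simp add: snoc.prems(5) w_def)
    ultimately show ?thesis by (simp add: put_def k_def)
  qed
  have dom: "dom v \<inter> Q = insert k S" using ins(1) by (auto simp: v S_def)
  have k: "k \<in> Q" "k \<in> {1..n}" "k \<notin> S" "k \<notin> dom w" using ins(1) by (auto simp: S_def)
  have m: "\<exists>X. matching e (set (xs @ [i])) Q (dom v \<inter> Q) X" using ins(2) dom by simp
  have mP: "(\<exists>X. matching e {a \<in> set (xs @ [i]). P (h a)} Q (filled Q P v) X) \<and>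
    card (filled Q P v) = card {a \<in> set (xs @ [i]). P (h a)}"
  proof (cases "P (h i)")
    case True
    then have all: "\<forall>i'\<in>set xs. P (h i')" using snoc.prems(4) by (auto simp: sorted_wrt_append)
    then have "filled Q P w = S" unfolding filled_def S_def using IH by blast
    then have "filled Q P v = insert k S" using k True unfolding filled_def v by auto
    moreover have "{a \<in> set (xs @ [i]). P (h a)} = set (xs @ [i])" using all True by auto
    ultimately show ?thesis using m dom S k snoc.prems(1) by (simp add: distinct_card)
  next
    case False
    then have "filled Q P v = filled Q P w" using k unfolding filled_def v by auto
    moreover have "{a \<in> set (xs @ [i]). P (h a)} = {i \<in> set xs. P (h i)}" using False by auto
    ultimately show ?thesis using IH by simp
  qed
  have vals: "\<forall>j\<in>Q. \<forall>y. v j = Some y \<longrightarrow> y \<in> h ` set (xs @ [i])"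
    using IH unfolding v by auto
  have "\<forall>j. j \<notin> Q \<longrightarrow> v j = v0 j" using IH k(1) unfolding v by auto
  then show ?case using vals m mP dom S k by auto
qed

definition low :: "(nat \<Rightarrow> nat) \<Rightarrow> nat \<Rightarrow> nat set" where
  "low u k = {i \<in> {1..n}. u i \<le> k}"

lemma low_subset: "low u k \<subseteq> {1..n}"
  by (auto simp: low_def)

lemma low_mono: "k \<le> l \<Longrightarrow> low u k \<subseteq> low u l"
  by (auto simp: low_def)

lemma finite_low [simp]: "finite (low u k)"
  by (simp add: low_def)

text \<open>Sizes decide which phase handles a level. If \<open>low u k\<close> has at most
  \<open>card q\<close> sites, its letters are all placed in Phase II, unchanged. If it has at least
  \<open>card q\<close>, all letters above \<open>k\<close> are placed in Phase I and raised by one,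
  so level \<open>Suc k\<close> is the complement of the sites they take. If \<open>card q\<close>
  lies strictly between consecutive sizes, level \<open>Suc k\<close> separates the two
  phases.\<close>

lemma queue_act_low:
  assumes q: "q \<subseteq> {1..n}"
  shows "card (low u k) \<le> card q \<Longrightarrow> low (queue_act n q u) k = set_R2 (low u k) q"
    and "card q \<le> card (low u k) \<Longrightarrow> low (queue_act n q u) (Suc k) = set_R2 (low u k) q"
    and "card (low u k) < card q \<Longrightarrow> card q < card (low u (Suc k)) \<Longrightarrow> low (queue_act n q u) (Suc k) = q"
    and "i \<in> {1..n} \<Longrightarrow> queue_act n q u i \<in> u ` {1..n} \<union> (\<lambda>i. u i + 1) ` {1..n}"
proof -
  define xs where "xs = sort_key u [1..<Suc n]"
  define ys where "ys = take (card q) xs"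
  define zs where "zs = drop (card q) xs"
  define w where "w = fold (phaseI_step n q u) (rev zs) Map.empty"
  define v where "v = fold (phaseII_step n q u) ys w"
  have fin: "finite q" and cq: "card q \<le> n"
    using q finite_subset card_mono[OF _ q] by auto
  have xs: "distinct xs" "set xs = {1..n}" "length xs = n" "sorted (map u xs)"
    by (auto simp: xs_def)
  have split: "xs = ys @ zs" by (simp add: ys_def zs_def)
  have len: "length ys = card q" "length zs = n - card q" using xs cq by (auto simp: ys_def zs_def)
  have dist: "distinct ys" "distinct zs" "set ys \<inter> set zs = {}" using xs(1) unfolding split by auto
  have un: "set ys \<union> set zs = {1..n}" using xs(2) unfolding split by auto
  have sub: "set ys \<subseteq> {1..n}" "set zs \<subseteq> {1..n}" using un by auto
  have sw: "sorted_wrt (\<lambda>i j. u i \<le> u j) ys" "sorted_wrt (\<lambda>i j. u i \<le> u j) zs"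
    and le: "\<And>i j. i \<in> set ys \<Longrightarrow> j \<in> set zs \<Longrightarrow> u i \<le> u j"
    using xs(4) unfolding split by (auto simp: sorted_wrt_map sorted_wrt_append)
  have Qc: "- q \<inter> {1..n} = {1..n} - q" by auto
  have cQc: "card (- q \<inter> {1..n}) = n - card q"
    unfolding Qc using card_Diff_subset[OF fin q] by simp
  have I: "(\<forall>j. j \<notin> - q \<longrightarrow> w j = None) \<and> (\<forall>j\<in>- q. \<forall>y. w j = Some y \<longrightarrow> y \<in> (\<lambda>i. u i + 1) ` set zs) \<and>
    dom w \<inter> - q \<subseteq> {1..n} \<and> card (dom w \<inter> - q) = n - card q \<and>
    (\<exists>X. matching (- 1) {i \<in> set zs. k < u i + 1} (- q) (filled (- q) (\<lambda>y. k < y) w) X) \<and>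
    card (filled (- q) (\<lambda>y. k < y) w) = card {i \<in> set zs. k < u i + 1}" for k
  proof -
    have "sorted_wrt (\<lambda>i j. k < u j + 1 \<longrightarrow> k < u i + 1) (rev zs)"
      unfolding sorted_wrt_rev by (rule sorted_wrt_mono_rel[OF _ sw(2)]) auto
    moreover have "length (rev zs) \<le> card (- q \<inter> {1..n})" using len cQc by simp
    moreover have "w = fold (put (left_site n) (- q) (\<lambda>i. u i + 1)) (rev zs) Map.empty"
      by (simp add: w_def phase_put)
    moreover have "distinct (rev zs)" "set (rev zs) \<subseteq> {1..n}" using dist sub by auto
    moreover have "left_site n (site t) = site (t + - 1)" for t by (simp add: left_site_site)
    ultimately show ?thesis
      using fold_put[of "- 1" "left_site n" Map.empty "- q" "rev zs" "\<lambda>y. k < y" "\<lambda>i. u i + 1" w] len(2)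
      by (simp only: set_rev length_rev dom_empty) blast
  qed
  have "dom w \<inter> q = {}" using I by auto
  have II: "(\<forall>j. j \<notin> q \<longrightarrow> v j = w j) \<and> (\<forall>j\<in>q. \<forall>y. v j = Some y \<longrightarrow> y \<in> u ` set ys) \<and>
    dom v \<inter> q \<subseteq> {1..n} \<and> card (dom v \<inter> q) = card q \<and>
    (\<exists>X. matching 1 {i \<in> set ys. u i \<le> k} q (filled q (\<lambda>y. y \<le> k) v) X) \<and>
    card (filled q (\<lambda>y. y \<le> k) v) = card {i \<in> set ys. u i \<le> k}" for k
  proof -
    have "sorted_wrt (\<lambda>i j. u j \<le> k \<longrightarrow> u i \<le> k) ys"
      by (rule sorted_wrt_mono_rel[OF _ sw(1)]) auto
    moreover have "length ys \<le> card (q \<inter> {1..n})" using len q by (simp add: Int_absorb2)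
    moreover have "v = fold (put (right_site n) q u) ys w"
      by (simp add: v_def phase_put)
    ultimately show ?thesis
      using fold_put[of 1 "right_site n" w q ys "\<lambda>y. y \<le> k" u v] len(1)
        right_site_site dist(1) sub(1) \<open>dom w \<inter> q = {}\<close> by (simp only: simp_thms) blast
  qed
  have dom: "q \<subseteq> dom v" "{1..n} - q \<subseteq> dom v"
  proof -
    have "dom v \<inter> q = q" using II fin by (intro card_subset_eq) auto
    then show "q \<subseteq> dom v" by blast
    have "dom w \<inter> - q = - q \<inter> {1..n}" using I cQc by (intro card_subset_eq) auto
    then have "{1..n} - q \<subseteq> dom w" by blast
    moreover have "v j = w j" if "j \<notin> q" for j using II that by blast
    ultimately show "{1..n} - q \<subseteq> dom v" by (metis (no_types, lifting) DiffD2 domIff subset_iff)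
  qed
  define V where "V = queue_act n q u"
  have act: "v i = Some (V i)" if "i \<in> {1..n}" for i
  proof -
    have "V i = the (v i)"
      using that unfolding V_def queue_act_def queue_run_def v_def w_def ys_def zs_def xs_def
      by (simp only: restrict_apply simp_thms if_True)
    moreover have "i \<in> dom v" using dom that by blast
    ultimately show ?thesis by auto
  qed
  have Vq: "V j \<in> u ` set ys" if "j \<in> q" for j
    using II act that q by blast
  have Vn: "V j \<in> (\<lambda>i. u i + 1) ` set zs" if "j \<in> {1..n} - q" for j
    using I II act that by (metis ComplI DiffE)
  show "V i \<in> u ` {1..n} \<union> (\<lambda>i. u i + 1) ` {1..n}" if "i \<in> {1..n}"
    using Vq[of i] Vn[of i] sub that by blast
  have low_un: "low u k = {i \<in> set ys. u i \<le> k} \<union> {i \<in> set zs. u i \<le> k}" for k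
    unfolding low_def un[symmetric] by auto
  have clow: "card (low u k) = card {i \<in> set ys. u i \<le> k} + card {i \<in> set zs. u i \<le> k}" for k
    unfolding low_un using dist by (intro card_Un_disjoint) auto
  have cys: "card (set ys) = card q" using dist len by (simp add: distinct_card)
  have small: "\<forall>i\<in>set zs. k < u i" if "card (low u k) \<le> card q" for k
  proof (rule ccontr)
    assume "\<not> (\<forall>i\<in>set zs. k < u i)"
    then obtain i where i: "i \<in> set zs" "u i \<le> k" by auto
    then have "{i \<in> set ys. u i \<le> k} = set ys" using le by (auto intro: order_trans)
    then have "card (low u k) = card q + card {i \<in> set zs. u i \<le> k}"
      unfolding clow by (simp only: cys)
    moreover have "card {i \<in> set zs. u i \<le> k} > 0" using i by (auto simp: card_gt_0_iff)
    ultimately show False using that by linarith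
  qed
  have large: "\<forall>i\<in>set ys. u i \<le> k" if "card q \<le> card (low u k)" for k
  proof (rule ccontr)
    assume "\<not> (\<forall>i\<in>set ys. u i \<le> k)"
    then obtain i where i: "i \<in> set ys" "k < u i" by auto
    then have "{i \<in> set zs. u i \<le> k} = {}" using le by fastforce
    then have "card (low u k) = card {i \<in> set ys. u i \<le> k}"
      unfolding clow by (simp only: card.empty add_0_right)
    moreover have "card {i \<in> set ys. u i \<le> k} < card (set ys)" using i
      by (intro psubset_card_mono psubsetI) force+
    ultimately show False using that cys by linarith
  qed
  show "low V k = set_R2 (low u k) q" if c: "card (low u k) \<le> card q"
  proof -
    have A: "{i \<in> set ys. u i \<le> k} = low u k" using small[OF c] unfolding low_un by auto
    have "k < V j" if "j \<in> {1..n} - q" for j using Vn[OF that] small[OF c] by auto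
    then have B: "filled q (\<lambda>y. y \<le> k) v = low V k"
      unfolding filled_def low_def using act q by fastforce
    have "low V k \<subseteq> q" unfolding B[symmetric] filled_def by blast
    moreover obtain X where "matching 1 (low u k) q (low V k) X" "card (low V k) = card (low u k)"
      using II[of k] unfolding A B by blast
    ultimately show ?thesis by (simp only: matching_right[OF _ low_subset q])
  qed
  show "low V (Suc k) = set_R2 (low u k) q" if c: "card q \<le> card (low u k)"
  proof -
    have A: "{i \<in> set zs. Suc k < u i + 1} = {1..n} - low u k"
      using large[OF c] dist(3) unfolding low_un un[symmetric] by auto
    have *: "V j \<le> k" if "j \<in> q" for j using Vq[OF that] large[OF c] by auto
    have B: "filled (- q) (\<lambda>y. Suc k < y) w = {1..n} - low V (Suc k)"
    proof (intro set_eqI iffI)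
      fix j assume "j \<in> filled (- q) (\<lambda>y. Suc k < y) w"
      then obtain y where y: "j \<notin> q" "w j = Some y" "Suc k < y" by (auto simp: filled_def)
      then have j: "j \<in> {1..n}" using I by blast
      moreover have "V j = y" using act[OF j] II y by auto
      ultimately show "j \<in> {1..n} - low V (Suc k)" using y by (auto simp: low_def)
    next
      fix j assume j: "j \<in> {1..n} - low V (Suc k)"
      then have "Suc k < V j" by (auto simp: low_def)
      moreover from this have "j \<notin> q" using *[of j] by auto
      ultimately show "j \<in> filled (- q) (\<lambda>y. Suc k < y) w"
        using act[of j] II j by (auto simp: filled_def)
    qed
    obtain X where X: "matching (- 1) ({1..n} - low u k) (- q) ({1..n} - low V (Suc k)) X"
      "card ({1..n} - low V (Suc k)) = card ({1..n} - low u k)"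
      using I[of "Suc k"] unfolding A B by blast
    have "matching (- 1) ({1..n} - low u k) ({1..n} - q) ({1..n} - low V (Suc k)) X"
      using X(1) unfolding matching_def by auto
    moreover have "card (low V (Suc k)) = card (low u k)"
    proof -
      have "card (low V (Suc k)) \<le> n" "card (low u k) \<le> n"
        using card_mono[OF _ low_subset] by (metis card_atLeastAtMost diff_Suc_1 finite_atLeastAtMost)+
      then show ?thesis using X(2) by (simp add: card_Diff_subset low_subset[simplified])
    qed
    moreover have "q \<subseteq> low V (Suc k)" using * q by (force simp: low_def)
    ultimately show ?thesis using matching_left[OF _ low_subset low_subset] by metis
  qed
  show "low V (Suc k) = q" if "card (low u k) < card q" "card q < card (low u (Suc k))"
  proof -
    have "V j \<le> Suc k" if "j \<in> q" for j
      using Vq[OF that] large[of "Suc k"] \<open>card q < card (low u (Suc k))\<close> by auto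
    moreover have "Suc k < V j" if "j \<in> {1..n} - q" for j
      using Vn[OF that] small[of k] \<open>card (low u k) < card q\<close> by auto
    ultimately show ?thesis using q unfolding low_def by fastforce
  qed
qed

subsection \<open>Exchanging two queues\<close>

lemma queue_act_words:
  assumes "q \<subseteq> {1..n}" "u \<in> words n"
  shows "queue_act n q u \<in> words n"
  unfolding words_def
proof (rule PiE_I)
  fix i assume "i \<in> {1..n}"
  from queue_act_low(4)[OF assms(1) this, of u] assms(2)
  show "queue_act n q u i \<in> {1..}" by (auto simp: words_def PiE_def Pi_def)
next
  fix i assume "i \<notin> {1..n}"
  then show "queue_act n q u i = undefined" by (auto simp: queue_act_def)
qed

lemma low_0: "u \<in> words n \<Longrightarrow> low u 0 = {}"
  by (fastforce simp: words_def low_def PiE_def Pi_def)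

lemma low_eventually_full: "low u (\<Sum>i=1..n. u i) = {1..n}"
  unfolding low_def using member_le_sum[of _ "{1..n}" u] by auto

lemma low_queue_act:
  assumes q: "q \<subseteq> {1..n}" and u: "u \<in> words n"
  shows "low (queue_act n q u) k =
    (if card (low u k) \<le> card q then set_R2 (low u k) q
     else if card q \<le> card (low u (k - 1)) then set_R2 (low u (k - 1)) q else q)"
proof (cases k)
  \<comment> \<open>The truncated \<open>k - 1\<close> is harmless here: \<open>low u 0\<close> is
    empty, so the first branch applies.\<close>
  case 0
  then show ?thesis using queue_act_low(1)[OF q, of u k] low_0[OF u] by simp
next
  case (Suc l)
  then show ?thesis using queue_act_low(1)[OF q, of u k] queue_act_low(2,3)[OF q, of u l] by auto
qed

text \<open>\<open>set_R2\<close> keeps the size of its first argument, so \<open>card q\<close> is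
  inserted in order into the sequence of level sizes; the formula is the median of two consecutive
  old sizes and \<open>card q\<close>.\<close>

lemma card_low_queue_act:
  assumes q: "q \<subseteq> {1..n}" and u: "u \<in> words n"
  shows "card (low (queue_act n q u) k) = max (card (low u (k - 1))) (min (card (low u k)) (card q))"
proof -
  have "card (low u (k - 1)) \<le> card (low u k)" by (intro card_mono low_mono) auto
  then show ?thesis
    unfolding low_queue_act[OF assms] using set_R_card(2)[OF low_subset q] by auto
qed

text \<open>Forgetting the indices removes the shift of levels in \<open>low_queue_act\<close>, so a
  queue acts by one uniform rule; \<open>word_eqI\<close> recovers the indices from the
  sizes.\<close>

definition flag :: "(nat \<Rightarrow> nat) \<Rightarrow> nat set set" where
  "flag u = range (low u)"

lemma flag_queue_act:
  assumes q: "q \<subseteq> {1..n}" and u: "u \<in> words n"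
  shows "flag (queue_act n q u) = insert q ((\<lambda>A. set_R2 A q) ` flag u)"
proof (intro equalityI subsetI)
  fix A assume "A \<in> flag (queue_act n q u)"
  then show "A \<in> insert q ((\<lambda>A. set_R2 A q) ` flag u)"
    unfolding flag_def using low_queue_act[OF assms] by auto
next
  have set_R2_mem: "set_R2 (low u k) q \<in> flag (queue_act n q u)" for k
  proof (cases "card (low u k) \<le> card q")
    case True
    then show ?thesis unfolding flag_def using queue_act_low(1)[OF q True] by (metis rangeI)
  next
    case False
    then have "low (queue_act n q u) (Suc k) = set_R2 (low u k) q" by (intro queue_act_low(2)[OF q]) simp
    then show ?thesis unfolding flag_def by (metis rangeI)
  qed
  have "q \<in> flag (queue_act n q u)"
  proof -
    \<comment> \<open>At the first level of size at least \<open>card q\<close>, either the sizes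
      agree and \<open>set_R2\<close> returns \<open>q\<close> itself, or \<open>card q\<close>
      falls strictly between two consecutive sizes.\<close>
    define k where "k = (LEAST k. card q \<le> card (low u k))"
    have "card q \<le> card (low u (\<Sum>i=1..n. u i))"
      unfolding low_eventually_full using card_mono[OF _ q] by simp
    then have k: "card q \<le> card (low u k)" "\<And>j. j < k \<Longrightarrow> card (low u j) < card q"
      unfolding k_def by (auto intro: LeastI dest: not_less_Least)
    show ?thesis
    proof (cases "card q = card (low u k)")
      case True
      then show ?thesis using set_R2_same_card[OF low_subset q, of u k] set_R2_mem[of k] by simp
    next
      case False
      then obtain j where j: "k = Suc j" using k(1) low_0[OF u] by (cases k) auto
      with k False have "low (queue_act n q u) (Suc j) = q"
        by (intro queue_act_low(3)[OF q]) auto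
      then show ?thesis unfolding flag_def by (metis rangeI)
    qed
  qed
  then show "A \<in> flag (queue_act n q u)" if "A \<in> insert q ((\<lambda>A. set_R2 A q) ` flag u)" for A
    using that set_R2_mem by (auto simp: flag_def)
qed

text \<open>Members of one chain are comparable by inclusion, so equal sizes force equal level
  sets.\<close>

lemma word_eqI:
  assumes u: "u \<in> words n" and w: "w \<in> words n" and flag: "flag u = flag w"
    and card: "\<And>k. card (low u k) = card (low w k)"
  shows "u = w"
proof -
  have low: "low u k = low w k" for k
  proof -
    obtain l where l: "low u k = low w l" using flag unfolding flag_def by blast
    show ?thesis
    proof (cases "k \<le> l")
      case True
      then show ?thesis using card_subset_eq[OF finite_low low_mono[OF True, of w]] card[of k] l by simp
    next
      case False
      then have "l \<le> k" by simp
      from card_subset_eq[OF finite_low low_mono[OF this, of w]] show ?thesis using card[of k] l by simp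
    qed
  qed
  have "u i = w i" if i: "i \<in> {1..n}" for i
  proof -
    have "i \<in> low u (u i)" "i \<in> low w (w i)" using i by (auto simp: low_def)
    then have "w i \<le> u i" "u i \<le> w i" using low by (auto simp: low_def)
    then show ?thesis by simp
  qed
  then show ?thesis using u w unfolding words_def by (intro PiE_ext)
qed

text \<open>The images of the level sets of \<open>u\<close> agree by \<open>set_R2_set_R2\<close>.
  The sets inserted by the queues are \<open>r\<close> and \<open>set_R2 q r\<close> on both sides,
  since by the involution the second queue sends \<open>set_R1 q r\<close> to
  \<open>r\<close>.\<close>

theorem queue_exchange:
  assumes q: "q \<subseteq> {1..n}" and r: "r \<subseteq> {1..n}" and u: "u \<in> words n"
  shows "queue_act n (set_R2 q r) (queue_act n (set_R1 q r) u) = queue_act n r (queue_act n q u)"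
proof -
  note S = set_R_subset(1)[of q r] set_R_subset(2)[of q r]
  note w = queue_act_words[OF q u] queue_act_words[OF S(1) u]
  show ?thesis
  proof (rule word_eqI)
    show "queue_act n (set_R2 q r) (queue_act n (set_R1 q r) u) \<in> words n"
      "queue_act n r (queue_act n q u) \<in> words n"
      by (intro queue_act_words S q r u)+
    have "(\<lambda>A. set_R2 (set_R2 A (set_R1 q r)) (set_R2 q r)) ` flag u = (\<lambda>A. set_R2 (set_R2 A q) r) ` flag u"
      unfolding flag_def using set_R2_set_R2[OF low_subset q r] by (auto simp: image_image)
    then show "flag (queue_act n (set_R2 q r) (queue_act n (set_R1 q r) u)) = flag (queue_act n r (queue_act n q u))"
      unfolding flag_queue_act[OF S(2) w(2)] flag_queue_act[OF S(1) u]
        flag_queue_act[OF r w(1)] flag_queue_act[OF q u]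
      by (simp add: image_image set_R_involution[OF q r] insert_commute)
    fix k
    \<comment> \<open>Inserting the sizes \<open>s\<close> and \<open>t\<close> into a sorted
      sequence gives the same result in either order; \<open>a\<close>, \<open>b\<close>,
      \<open>c\<close> stand for three consecutive sizes.\<close>
    have "max (max a (min b s)) (min (max b (min c s)) t) = max (max a (min b t)) (min (max b (min c t)) s)"
      if "a \<le> b" "b \<le> c" for a b c s t :: nat
      using that by (auto simp: min_def max_def)
    moreover have "card (low u (k - 1 - 1)) \<le> card (low u (k - 1))" "card (low u (k - 1)) \<le> card (low u k)"
      by (intro card_mono low_mono; simp)+
    ultimately show "card (low (queue_act n (set_R2 q r) (queue_act n (set_R1 q r) u)) k)
        = card (low (queue_act n r (queue_act n q u)) k)"
      unfolding card_low_queue_act[OF S(2) w(2)] card_low_queue_act[OF S(1) u]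
        card_low_queue_act[OF r w(1)] card_low_queue_act[OF q u] set_R_card[OF q r]
      by blast
  qed
qed

lemma queue_wt_exchange:
  assumes q: "q \<subseteq> {1..n}" and r: "r \<subseteq> {1..n}"
  shows "queue_wt (set_R1 q r) * queue_wt (set_R2 q r) = queue_wt q * queue_wt r"
proof -
  have wt: "queue_wt s = (\<Prod>i=1..n. Var i ^ of_bool (i \<in> s))" if "s \<subseteq> {1..n}" for s
  proof -
    have "(\<Prod>i\<in>s. Var i) = (\<Prod>i\<in>s. Var i ^ of_bool (i \<in> s))" by (intro prod.cong) auto
    also have "\<dots> = (\<Prod>i=1..n. Var i ^ of_bool (i \<in> s))"
      using that by (intro prod.mono_neutral_left) auto
    finally show ?thesis by (simp only: queue_wt_def)
  qed
  show ?thesis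
    by (simp only: wt q r set_R_subset flip: prod.distrib power_add) (simp only: set_R_sum[OF q r])
qed

section \<open>Weighted sums over sequences of queues of prescribed sizes\<close>

primrec queue_sum :: "nat list \<Rightarrow> (nat \<Rightarrow> nat) \<Rightarrow> (nat \<Rightarrow> nat) \<Rightarrow> int_mpoly" where
  "queue_sum [] w u = (if w = u then 1 else 0)"
| "queue_sum (r # rs) w u = (\<Sum>q\<in>queues n r. queue_wt q * queue_sum rs (queue_act n q w) u)"

lemma queue_sum_swap:
  assumes w: "w \<in> words n"
  shows "queue_sum (a # b # rs) w u = queue_sum (b # a # rs) w u"
proof -
  let ?T = "\<lambda>(q, r). queue_wt q * queue_wt r * queue_sum rs (queue_act n r (queue_act n q w)) u"
  have expand: "queue_sum (a # b # rs) w u = sum ?T (queues n a \<times> queues n b)" for a b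
    by (simp add: sum.cartesian_product[symmetric] sum_distrib_left mult.assoc)
  let ?ex = "\<lambda>(q, r). (set_R1 q r, set_R2 q r)"
  have "sum ?T (queues n a \<times> queues n b) = sum ?T (queues n b \<times> queues n a)"
  proof (rule sum.reindex_bij_witness[where i = ?ex and j = ?ex])
    show "?ex (?ex x) = x" "?ex x \<in> queues n b \<times> queues n a" if "x \<in> queues n a \<times> queues n b" for a b x
    proof -
      obtain q r where x: "x = (q, r)" by (cases x)
      then have qr: "q \<subseteq> {1..n}" "r \<subseteq> {1..n}" "card q = a" "card r = b"
        using that by (simp_all add: queues_def)
      show "?ex (?ex x) = x" unfolding x using set_R_involution[OF qr(1,2)] by simp
      show "?ex x \<in> queues n b \<times> queues n a"
        unfolding x queues_def using set_R_card[OF qr(1,2)] set_R_subset[of q r] qr(3,4) by simp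
    qed
    then show "?ex (?ex x) = x" "?ex x \<in> queues n a \<times> queues n b" if "x \<in> queues n b \<times> queues n a" for x
      using that by blast+
    show "?T (?ex x) = ?T x" if "x \<in> queues n a \<times> queues n b" for x
    proof -
      obtain q r where x: "x = (q, r)" by (cases x)
      then have qr: "q \<subseteq> {1..n}" "r \<subseteq> {1..n}" using that by (simp_all add: queues_def)
      show ?thesis unfolding x using queue_wt_exchange[OF qr] queue_exchange[OF qr w] by simp
    qed
  qed
  then show ?thesis by (simp only: expand)
qed

lemma queue_sum_cong_Cons:
  assumes "w \<in> words n" "\<And>w. w \<in> words n \<Longrightarrow> queue_sum rs w u = queue_sum rs' w u"
  shows "queue_sum (r # rs) w u = queue_sum (r # rs') w u"
proof -
  have "queue_act n q w \<in> words n" if "q \<in> queues n r" for q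
    using that assms(1) by (intro queue_act_words) (auto simp: queues_def)
  then show ?thesis using assms(2) by (auto intro!: sum.cong)
qed

lemma queue_sum_move:
  "w \<in> words n \<Longrightarrow> queue_sum (xs @ y # ys) w u = queue_sum (y # xs @ ys) w u"
proof (induction xs arbitrary: w)
  case (Cons x xs)
  have "queue_sum (x # xs @ y # ys) w u = queue_sum (x # y # xs @ ys) w u"
    using Cons by (intro queue_sum_cong_Cons) auto
  also have "\<dots> = queue_sum (y # x # xs @ ys) w u" by (rule queue_sum_swap[OF Cons.prems])
  finally show ?case by simp
qed simp

lemma queue_sum_mset:
  "w \<in> words n \<Longrightarrow> mset rs = mset rs' \<Longrightarrow> queue_sum rs w u = queue_sum rs' w u"
proof (induction rs arbitrary: rs' w)
  case (Cons r rs)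
  then have "r \<in> set rs'" by (metis list.set_intros(1) set_mset_mset)
  then obtain xs ys where rs': "rs' = xs @ r # ys" by (meson split_list)
  then have "mset rs = mset (xs @ ys)" using Cons.prems(2) by simp
  with Cons have "queue_sum (r # rs) w u = queue_sum (r # xs @ ys) w u"
    by (intro queue_sum_cong_Cons) auto
  then show ?case using queue_sum_move[OF Cons.prems(1)] rs' by simp
qed simp

lemma queue_sum_eq:
  "queue_sum rs w u =
    (\<Sum>qs | list_all2 (\<lambda>q r. q \<in> queues n r) qs rs \<and> mlq_act n qs w = u. mlq_wt qs)"
proof (induction rs arbitrary: w)
  case Nil
  have "{qs. qs = [] \<and> mlq_act n qs w = u} = (if w = u then {[]} else {})"
    by (auto simp: mlq_act_def)
  then show ?case by (simp add: mlq_wt_def)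
next
  case (Cons r rs)
  let ?F = "\<lambda>rs w. {qs. list_all2 (\<lambda>q r. q \<in> queues n r) qs rs \<and> mlq_act n qs w = u}"
  have fin: "finite (?F rs w)" for w
  proof (rule finite_subset)
    show "?F rs w \<subseteq> {qs. set qs \<subseteq> Pow {1..n} \<and> length qs = length rs}"
    proof clarify
      fix qs assume qs: "list_all2 (\<lambda>q r. q \<in> queues n r) qs rs"
      have "q \<subseteq> {1..n}" if "q \<in> set qs" for q
        using list_all2_nthD[OF qs] that unfolding in_set_conv_nth queues_def by blast
      then show "set qs \<subseteq> Pow {1..n} \<and> length qs = length rs"
        using list_all2_lengthD[OF qs] by blast
    qed
  qed (intro finite_lists_length_eq, simp)
  have finq: "finite (queues n r)" by (auto simp: queues_def)
  have "queue_sum (r # rs) w u = (\<Sum>q\<in>queues n r. \<Sum>qs\<in>?F rs (queue_act n q w). queue_wt q * mlq_wt qs)"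
    by (simp add: Cons.IH sum_distrib_left)
  also have "\<dots> = (\<Sum>(q, qs)\<in>(SIGMA q:queues n r. ?F rs (queue_act n q w)). queue_wt q * mlq_wt qs)"
    using fin finq by (intro sum.Sigma) auto
  also have "\<dots> = (\<Sum>qs\<in>?F (r # rs) w. mlq_wt qs)"
    by (rule sum.reindex_bij_witness[where i = "\<lambda>qs. (hd qs, tl qs)" and j = "\<lambda>(q, qs). q # qs"])
      (auto simp: mlq_act_def mlq_wt_def list_all2_Cons2)
  finally show ?case by simp
qed

end

section \<open>Spectral weights as sums over queues with a given list of sizes\<close>

lemma twisted_mlqs_list_all2:
  "twisted_mlqs n m \<sigma> =
    {qs. list_all2 (\<lambda>q r. q \<in> queues n r) qs (map (\<lambda>i. psum m (\<sigma> i)) [1..<num_classes m])}"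
proof (rule set_eqI)
  fix qs
  define N where "N = num_classes m - 1"
  let ?f = "\<lambda>i. psum m (\<sigma> i)"
  have "(\<forall>i\<in>{1..N}. qs ! (i - 1) \<in> queues n (?f i)) \<longleftrightarrow> (\<forall>i<N. qs ! i \<in> queues n (?f (Suc i)))"
    unfolding image_Suc_lessThan[symmetric] by auto
  moreover have "map ?f [1..<num_classes m] ! i = ?f (Suc i)" if "i < N" for i
    using that by (simp add: N_def)
  ultimately show "qs \<in> twisted_mlqs n m \<sigma> \<longleftrightarrow>
      qs \<in> {qs. list_all2 (\<lambda>q r. q \<in> queues n r) qs (map (\<lambda>i. psum m (\<sigma> i)) [1..<num_classes m])}"
    unfolding twisted_mlqs_def list_all2_conv_all_nth N_def[symmetric]
    by (auto simp: N_def)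
qed

theorem theorem3p1:
  fixes n l :: nat and u m \<sigma> :: "nat \<Rightarrow> nat"
  assumes "n > 0"
    and "u \<in> words n"
    and "m = word_type n u"
    and "packed m"
    and "l = num_classes m"
    and "\<sigma> permutes {1..l - 1}"
  shows "twisted_spectral_weight n \<sigma> u = spectral_weight n u"
proof -
  interpret cyclic_sites n by unfold_locales fact
  define sizes where "sizes \<tau> = map (\<lambda>i. psum m (\<tau> i)) [1..<l]" for \<tau>
  have eq: "twisted_spectral_weight n \<tau> u = queue_sum (sizes \<tau>) (ones n) u" for \<tau>
    unfolding twisted_spectral_weight_def queue_sum_eq sizes_def assms(3)[symmetric] assms(5)
    by (simp add: twisted_mlqs_list_all2)
  have ones: "ones n \<in> words n" by (auto simp: ones_def words_def)
  \<comment> \<open>\<open>\<sigma>\<close> permutes the indices, so it only rearranges the list of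
    queue sizes.\<close>
  have "mset (sizes \<sigma>) = mset (sizes id)"
  proof -
    have "{1..<l} = {1..l - 1}" by auto
    then have "image_mset \<sigma> (mset_set {1..<l}) = mset_set {1..<l}"
      using assms(6) by (simp only: image_mset_mset_set permutes_inj_on permutes_image)
    then have "image_mset (psum m) (image_mset \<sigma> (mset [1..<l])) = image_mset (psum m) (mset [1..<l])"
      by (simp only: mset_upt)
    then show ?thesis by (simp add: sizes_def multiset.map_comp comp_def)
  qed
  from queue_sum_mset[OF ones this] show ?thesis by (simp only: spectral_weight_def eq)
qed

end
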